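(* Let $\ell\geq 2$ be an integer. For every positive integer $k$ and every graph $G$, either $G$ contains $k$ pairwise edge-disjoint cycles each of length at least $\ell$, or there is a set $F\subseteq E(G)$ with $|F|\leq 8k(\ell-1)(\lceil\log_2(k\ell)\rceil+1)$ such that $G-F$ contains no cycle of length at least $\ell$.
   Context: $G-F$ denotes the graph obtained from $G$ by deleting the edges in $F$. This is the statement that cycles of length at least $\ell$ have the edge-Erdős–Pósa property with bounding function $f(k)=8k(\ell-1)(\lceil\log_2(k\ell)\rceil+1)$. *)

theory Defs
  imports Complex_Main
begin

record 'v ugraph =
  verts :: "'v set"
  edges :: "'v set set"

definition finite_simple_graph :: "'v ugraph \<Rightarrow> bool" where
  "finite_simple_graph G \<longleftrightarrow>
     finite (verts G) \<and> (\<forall>e \<in> edges G. e \<subseteq> verts G \<and> card e = 2)"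

definition delete_edges :: "'v ugraph \<Rightarrow> 'v set set \<Rightarrow> 'v ugraph" where
  "delete_edges G F = \<lparr>verts = verts G, edges = edges G - F\<rparr>"

text \<open>
  A cycle is given by the list of its vertices in cyclic order, without repeating the
  first vertex at the end; hence the length of the list is the number of edges of the cycle.
\<close>

definition cycle_edges :: "'v list \<Rightarrow> 'v set set" where
  "cycle_edges c = {{c ! i, c ! (Suc i mod length c)} | i. i < length c}"

definition is_cycle :: "'v ugraph \<Rightarrow> 'v list \<Rightarrow> bool" where
  "is_cycle G c \<longleftrightarrow>
     3 \<le> length c \<and> distinct c \<and> set c \<subseteq> verts G \<and> cycle_edges c \<subseteq> edges G"

end

theory Submission
  imports Defs "HOL-Library.Disjoint_Sets"
begin

text \<open>
  Induction on k: a circuit of length between l and W, the cost allowed per circuit, is simply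
  deleted, so suppose there is none. Then lying on a common circuit shorter than l is an
  equivalence relation on the edges, because the union of two such circuits is still shorter
  than W; its classes have small diameter, and the circuits of length at least l are exactly
  those not contained in a class. They leave a trace, an even edge set, in the bipartite incidence
  graph between vertices and classes. If the 2-core of this graph has many more edges than
  vertices, spanning trees of the classes already contain k edge-disjoint long circuits.
  Otherwise the core has a cycle with only O(log k) branch nodes, obtained by doubling. It is
  realised by a short piece in each class that is a branch node and, in each other class, by a
  path whose removal lowers the relevant edge connectivity by at most one (Menger). Deleting this
  realisation lowers the packing number, and a hitting set of the remainder extends to the whole
  graph at the cost of the short pieces and one extra edge for each run of the cycle between
  branch nodes.
\<close>

section \<open>Parity of edge sets and circuits\<close>

text \<open>The length of a long circuit is not bounded in terms of k and l, so a hitting set cannot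
  simply contain the circuit that is split off. Even a cycle of the incidence graph with few branch
  nodes may pass through arbitrarily many classes. Only branch classes can afford to lose a whole
  piece, of at most l - 1 edges; elsewhere the removed path may be long, and what is paid for is the
  change in edge cuts.

  The constants: if k is at most 2^K and the core has at most k(4K+8) more edges than vertices,
  there is a cycle with at most 2(2K+3)+1 = 4K+7 branch nodes, hence with at most 4K+8 runs. Pieces
  and cuts then cost at most (4K+8) l, and this is at most W = 2(l-1)(4K+8) because l is at least 2.

  Paths are treated modulo 2. An edge set whose odd vertices are a and b stands for a path from a to
  b: such sets add by symmetric difference, parts in different classes can be exchanged
  independently, and a circuit is recovered from evenness alone.\<close>

definition simple_edges :: "'a set set \<Rightarrow> bool" where
  "simple_edges E \<longleftrightarrow> finite E \<and> (\<forall>e\<in>E. card e = 2)"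

definition deg :: "'a set set \<Rightarrow> 'a \<Rightarrow> nat" where
  "deg H v = card {e \<in> H. v \<in> e}"

text \<open>The boundary over the two-element field; the edge sets with empty boundary form the
  cycle space.\<close>

definition odds :: "'a set set \<Rightarrow> 'a set" where
  "odds H = {v. odd (deg H v)}"

abbreviation conn :: "'a set set \<Rightarrow> 'a \<Rightarrow> 'a \<Rightarrow> bool" where
  "conn E \<equiv> (\<lambda>u v. {u, v} \<in> E)\<^sup>*\<^sup>*"

definition circuit :: "'a set set \<Rightarrow> bool" where
  "circuit C \<longleftrightarrow> (\<exists>c. 3 \<le> length c \<and> distinct c \<and> cycle_edges c = C)"

lemma simple_edges_subset: "simple_edges E \<Longrightarrow> F \<subseteq> E \<Longrightarrow> simple_edges F"
  by (auto simp: simple_edges_def finite_subset)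

lemma simple_edges_finite: "simple_edges E \<Longrightarrow> finite E"
  by (auto simp: simple_edges_def)

lemma simple_edges_edge_finite: "simple_edges E \<Longrightarrow> e \<in> E \<Longrightarrow> finite e"
  unfolding simple_edges_def by (metis card.infinite zero_neq_numeral)

lemma simple_edges_finite_Union: "simple_edges E \<Longrightarrow> finite (\<Union>E)"
  using simple_edges_edge_finite simple_edges_finite by blast

lemma simple_edgesE:
  assumes "simple_edges E" "e \<in> E"
  obtains u v where "e = {u, v}" "u \<noteq> v"
  using assms unfolding simple_edges_def by (meson card_2_iff)

lemma simple_edges_neq: "simple_edges E \<Longrightarrow> {u, v} \<in> E \<Longrightarrow> u \<noteq> v"
  by (fastforce simp: simple_edges_def)

lemma even_card_sym_diff:
  assumes "finite A" "finite B"
  shows "even (card (sym_diff A B)) \<longleftrightarrow> (even (card A) \<longleftrightarrow> even (card B))"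
proof -
  have "card (sym_diff A B) = card (A - B) + card (B - A)"
    using assms by (subst card_Un_disjoint) auto
  moreover have "card A = card (A - B) + card (A \<inter> B)" "card B = card (B - A) + card (A \<inter> B)"
    using assms by (subst card_Un_disjoint[symmetric]; auto intro: arg_cong[where f=card])+
  ultimately show ?thesis by presburger
qed

lemma odds_sym_diff:
  assumes "finite A" "finite B"
  shows "odds (sym_diff A B) = sym_diff (odds A) (odds B)"
proof -
  have "{e \<in> sym_diff A B. v \<in> e} = sym_diff {e \<in> A. v \<in> e} {e \<in> B. v \<in> e}" for v
    by auto
  then have "even (deg (sym_diff A B) v) \<longleftrightarrow> (even (deg A v) \<longleftrightarrow> even (deg B v))" for v
    unfolding deg_def using even_card_sym_diff[of "{e \<in> A. v \<in> e}" "{e \<in> B. v \<in> e}"] assms by simp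
  then show ?thesis unfolding odds_def by auto
qed

lemma odds_empty [simp]: "odds {} = {}"
  by (simp add: odds_def deg_def)

lemma odds_singleton [simp]: "odds {e} = e"
proof -
  have "{x \<in> {e}. v \<in> x} = (if v \<in> e then {e} else {})" for v by auto
  then show ?thesis by (auto simp: odds_def deg_def)
qed

lemma odds_Un_disjoint:
  assumes "finite A" "finite B" "A \<inter> B = {}"
  shows "odds (A \<union> B) = sym_diff (odds A) (odds B)"
proof -
  have "sym_diff A B = A \<union> B" using assms by auto
  then show ?thesis using odds_sym_diff[OF assms(1,2)] by simp
qed

lemma odds_Diff:
  assumes "finite A" "B \<subseteq> A"
  shows "odds (A - B) = sym_diff (odds A) (odds B)"
proof -
  have "sym_diff A B = A - B" using assms by auto
  then show ?thesis using odds_sym_diff[of A B] assms finite_subset by metis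
qed

lemma odds_subset_Union: "odds H \<subseteq> \<Union>H"
proof
  fix v assume "v \<in> odds H"
  then have "odd (card {e \<in> H. v \<in> e})" by (simp add: odds_def deg_def)
  then have "{e \<in> H. v \<in> e} \<noteq> {}" by (metis card.empty even_zero)
  then show "v \<in> \<Union>H" by auto
qed

lemma finite_odds: "simple_edges H \<Longrightarrow> finite (odds H)"
  using odds_subset_Union simple_edges_finite_Union finite_subset by metis

text \<open>Handshake lemma: each added edge toggles exactly two vertices.\<close>

lemma even_card_odds:
  assumes "simple_edges H" shows "even (card (odds H))"
proof -
  have "finite H" "\<forall>e\<in>H. card e = 2" using assms by (auto simp: simple_edges_def)
  then show ?thesis
  proof (induction H rule: finite_induct)
    case empty then show ?case by simp
  next
    case (insert e H)
    have "odds (insert e H) = sym_diff (odds {e}) (odds H)"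
      using odds_Un_disjoint[of "{e}" H] insert by simp
    moreover have "simple_edges H" "finite e" using insert
      by (auto simp: simple_edges_def intro: card_ge_0_finite)
    ultimately show ?case
      using even_card_sym_diff[of e "odds H"] insert finite_odds[of H] by simp
  qed
qed

section \<open>Connectivity and edge sets with prescribed odd vertices\<close>

lemma conn_sym: "conn E u v \<Longrightarrow> conn E v u"
proof (induction rule: rtranclp_induct)
  case (step y z)
  then have "{z, y} \<in> E" by (simp add: insert_commute)
  then show ?case using step by (meson converse_rtranclp_into_rtranclp)
qed simp

lemma conn_mono: "E \<subseteq> F \<Longrightarrow> conn E u v \<Longrightarrow> conn F u v"
  by (rule rtranclp_mono[THEN predicate2D, rotated]) auto

lemma conn_trans: "conn E u v \<Longrightarrow> conn E v w \<Longrightarrow> conn E u w"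
  by simp

lemma conn_edge: "{u, v} \<in> E \<Longrightarrow> conn E u v"
  by auto

text \<open>Toggling one more edge moves the far end of the boundary. The form
  \<open>sym_diff {a} {b}\<close> is empty for a = b, which lets the induction pass through closed
  walks.\<close>

lemma conn_imp_chain:
  assumes "simple_edges E" "conn E a b"
  shows "\<exists>R\<subseteq>E. odds R = sym_diff {a} {b}"
  using assms(2)
proof (induction rule: rtranclp_induct)
  case base then show ?case by (intro exI[of _ "{}"]) auto
next
  case (step b c)
  then obtain R where R: "R \<subseteq> E" "odds R = sym_diff {a} {b}" by auto
  have "b \<noteq> c" using simple_edges_neq[OF assms(1)] step by blast
  have "odds (sym_diff R {{b, c}}) = sym_diff (odds R) (odds {{b, c}})"
    using R assms finite_subset by (intro odds_sym_diff) (auto simp: simple_edges_def)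
  then have "odds (sym_diff R {{b, c}}) = sym_diff {a} {c}"
    using R \<open>b \<noteq> c\<close> by auto
  then show ?case using R step by (intro exI[of _ "sym_diff R {{b, c}}"]) auto
qed

text \<open>The handshake lemma in the component of a: it holds an even number of odd vertices, so a
  is not the only one.\<close>

lemma chain_imp_conn:
  assumes "simple_edges R" "a \<in> odds R"
  shows "\<exists>b\<in>odds R. b \<noteq> a \<and> conn R a b"
proof -
  define K where "K = {v. conn R a v}"
  define RK where "RK = {e \<in> R. e \<inter> K \<noteq> {}}"
  have sub: "e \<subseteq> K" if "e \<in> RK" for e
  proof -
    have "e \<in> R" using that by (simp add: RK_def)
    then obtain u v where "e = {u, v}" using simple_edgesE[OF assms(1)] by metis
    moreover have "{v, u} = {u, v}" by auto
    ultimately have "{u, v} \<in> R" "{v, u} \<in> R" "u \<in> K \<or> v \<in> K"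
      using that unfolding RK_def by auto
    then have "u \<in> K" "v \<in> K"
      unfolding K_def by (metis conn_edge conn_trans mem_Collect_eq)+
    then show ?thesis using \<open>e = {u, v}\<close> by simp
  qed
  have "{e \<in> RK. v \<in> e} = (if v \<in> K then {e \<in> R. v \<in> e} else {})" for v
    using sub by (auto simp: RK_def)
  then have degK: "deg RK v = (if v \<in> K then deg R v else 0)" for v
    unfolding deg_def by (simp only: if_distrib[of card] card.empty)
  have "odds RK = odds R \<inter> K"
  proof (rule set_eqI)
    fix v show "v \<in> odds RK \<longleftrightarrow> v \<in> odds R \<inter> K"
      using degK[of v] by (cases "v \<in> K") (simp_all add: odds_def)
  qed
  moreover have "simple_edges RK"
    by (rule simple_edges_subset[OF assms(1)]) (auto simp: RK_def)
  then have "even (card (odds RK))" by (rule even_card_odds)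
  moreover have "a \<in> odds R \<inter> K" using assms by (auto simp: K_def)
  ultimately have "odds R \<inter> K \<noteq> {a}" by auto
  then show ?thesis using \<open>a \<in> odds R \<inter> K\<close> unfolding K_def by blast
qed

lemma chain_imp_conn2:
  assumes "simple_edges R" "odds R = {a, b}" "a \<noteq> b"
  shows "conn R a b"
  using chain_imp_conn[OF assms(1), of a] assms by auto

lemma conn_imp_chain2:
  assumes "simple_edges E" "conn E a b" "a \<noteq> b"
  shows "\<exists>R\<subseteq>E. odds R = {a, b}"
proof -
  have "sym_diff {a} {b} = {a, b}" using assms by auto
  then show ?thesis using conn_imp_chain[OF assms(1,2)] by simp
qed

section \<open>Simple paths as vertex lists\<close>

lemma rtranclp_imp_path:
  assumes "r\<^sup>*\<^sup>* a b"
  shows "\<exists>p. p \<noteq> [] \<and> hd p = a \<and> last p = b \<and> distinct p \<and> successively r p"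
  using assms
proof (induction rule: rtranclp_induct)
  case base then show ?case by (intro exI[of _ "[a]"]) auto
next
  case (step y z)
  then obtain p where p: "p \<noteq> []" "hd p = a" "last p = y" "distinct p" "successively r p" by blast
  show ?case
  proof (cases "z \<in> set p")
    case True
    \<comment> \<open>The walk returns to a vertex of p; cutting p back to that vertex keeps it
      distinct.\<close>
    then obtain q s where "p = q @ z # s" by (meson split_list)
    then show ?thesis using p
      by (intro exI[of _ "q @ [z]"]) (auto simp: successively_append_iff hd_append)
  next
    case False
    then show ?thesis using p step
      by (intro exI[of _ "p @ [z]"]) (auto simp: successively_append_iff)
  qed
qed

lemma path_imp_rtranclp:
  "p \<noteq> [] \<Longrightarrow> successively r p \<Longrightarrow> r\<^sup>*\<^sup>* (hd p) (last p)"
  by (induction p rule: induct_list012) (auto intro: converse_rtranclp_into_rtranclp)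

definition path_edges :: "'a list \<Rightarrow> 'a set set" where
  "path_edges p = {{p ! i, p ! Suc i} | i. Suc i < length p}"

lemma path_edges_Nil [simp]: "path_edges [] = {}"
  and path_edges_single [simp]: "path_edges [x] = {}"
  by (auto simp: path_edges_def)

lemma path_edges_Cons: "path_edges (x # y # p) = insert {x, y} (path_edges (y # p))"
proof -
  have "{(x # y # p) ! i, (x # y # p) ! Suc i} \<in> insert {x, y} (path_edges (y # p))"
    if "Suc i < length (x # y # p)" for i
    using that by (cases i) (auto simp: path_edges_def)
  moreover have "{x, y} \<in> path_edges (x # y # p)" unfolding path_edges_def
    by (intro CollectI exI[of _ 0]) auto
  moreover have "{(y # p) ! i, (y # p) ! Suc i} \<in> path_edges (x # y # p)"
    if "Suc i < length (y # p)" for i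
    unfolding path_edges_def using that by (intro CollectI exI[of _ "Suc i"]) auto
  ultimately show ?thesis unfolding path_edges_def[of "x # y # p"] path_edges_def[of "y # p"]
    by (smt (verit) Collect_mono_iff insert_Collect mem_Collect_eq subsetI subset_antisym insert_iff)
qed

lemma path_edges_subset_iff: "path_edges p \<subseteq> E \<longleftrightarrow> successively (\<lambda>u v. {u, v} \<in> E) p"
  by (induction p rule: induct_list012) (auto simp: path_edges_Cons)

lemma path_edges_append:
  "p \<noteq> [] \<Longrightarrow> q \<noteq> [] \<Longrightarrow> path_edges (p @ q) = insert {last p, hd q} (path_edges p \<union> path_edges q)"
proof (induction p rule: induct_list012)
  case (2 x) then show ?case by (cases q) (auto simp: path_edges_Cons)
qed (auto simp: path_edges_Cons)

lemma path_edges_rev: "path_edges (rev p) = path_edges p"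
proof (induction p rule: induct_list012)
  case (3 x y p)
  have "path_edges (rev (y # p) @ [x]) = insert {y, x} (path_edges (rev (y # p)))"
    by (subst path_edges_append) auto
  then show ?case using 3 by (simp add: path_edges_Cons insert_commute)
qed auto

lemma path_edges_Union: "\<Union>(path_edges p) \<subseteq> set p"
  by (auto simp: path_edges_def)

lemma path_edges_finite: "finite (path_edges p)"
  by (induction p rule: induct_list012) (auto simp: path_edges_Cons)

lemma odds_path_edges:
  "distinct p \<Longrightarrow> p \<noteq> [] \<Longrightarrow> odds (path_edges p) = sym_diff {hd p} {last p}"
proof (induction p rule: induct_list012)
  case (3 x y p)
  have "{x, y} \<notin> path_edges (y # p)" using 3 path_edges_Union[of "y # p"] by auto
  then have "odds (path_edges (x # y # p)) = sym_diff {x, y} (odds (path_edges (y # p)))"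
    using odds_Un_disjoint[of "{{x, y}}" "path_edges (y # p)"]
    by (simp add: path_edges_Cons path_edges_finite)
  also have "odds (path_edges (y # p)) = sym_diff {y} {last (y # p)}" using 3 by auto
  finally show ?case using 3(3) by (auto split: if_splits)
qed auto

lemma card_path_edges: "distinct p \<Longrightarrow> card (path_edges p) = length p - 1"
proof (induction p rule: induct_list012)
  case (3 x y p)
  have "{x, y} \<notin> path_edges (y # p)" using 3 path_edges_Union[of "y # p"] by auto
  then show ?case using 3 by (simp add: path_edges_Cons path_edges_finite)
qed auto

section \<open>Cycles as vertex lists, and circuits as their edge sets\<close>

lemma cycle_edges_path:
  assumes "p \<noteq> []"
  shows "cycle_edges p = insert {last p, hd p} (path_edges p)"
proof -
  have "{p ! i, p ! (Suc i mod length p)} \<in> insert {last p, hd p} (path_edges p)" if "i < length p" for i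
  proof (cases "Suc i = length p")
    case True
    then have "i = length p - 1" by simp
    then show ?thesis using True assms by (simp add: last_conv_nth hd_conv_nth)
  next
    case False
    then show ?thesis using that by (auto simp: path_edges_def)
  qed
  moreover have "{last p, hd p} \<in> cycle_edges p" unfolding cycle_edges_def
    using assms by (intro CollectI exI[of _ "length p - 1"]) (auto simp: last_conv_nth hd_conv_nth)
  moreover have "path_edges p \<subseteq> cycle_edges p" unfolding path_edges_def cycle_edges_def
  proof clarify
    fix i assume "Suc i < length p"
    then show "\<exists>j. {p ! i, p ! Suc i} = {p ! j, p ! (Suc j mod length p)} \<and> j < length p"
      by (intro exI[of _ i]) auto
  qed
  ultimately show ?thesis unfolding cycle_edges_def by blast
qed

text \<open>With only two vertices the closing edge would be the path edge itself.\<close>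

lemma cycle_closing_edge:
  assumes "3 \<le> length p" "distinct p"
  shows "{last p, hd p} \<notin> path_edges p"
proof
  assume "{last p, hd p} \<in> path_edges p"
  then obtain i where i: "Suc i < length p" "{last p, hd p} = {p ! i, p ! Suc i}"
    by (auto simp: path_edges_def)
  have "p \<noteq> []" using assms by auto
  then have "last p = p ! (length p - 1)" "hd p = p ! 0" by (auto simp: last_conv_nth hd_conv_nth)
  then have "{p ! (length p - 1), p ! 0} = {p ! i, p ! Suc i}" using i by simp
  then consider "p ! (length p - 1) = p ! i" | "p ! (length p - 1) = p ! Suc i" "p ! 0 = p ! i"
    by (auto simp: doubleton_eq_iff)
  then show False
  proof cases
    case 1
    then show False using i assms by (simp add: nth_eq_iff_index_eq)
  next
    case 2
    then have "length p - 1 = Suc i" "0 = i"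
      using i assms by (simp_all add: nth_eq_iff_index_eq flip: length_greater_0_conv)
    then show False using assms by simp
  qed
qed

lemma card_cycle_edges:
  assumes "3 \<le> length c" "distinct c" shows "card (cycle_edges c) = length c"
  using cycle_closing_edge[OF assms] cycle_edges_path[of c] card_path_edges[of c] assms
  by (cases "c = []") (auto simp: path_edges_finite)

lemma finite_cycle_edges [simp]: "finite (cycle_edges c)"
  by (simp add: cycle_edges_def)

lemma odds_cycle_edges:
  assumes "3 \<le> length c" "distinct c" shows "odds (cycle_edges c) = {}"
proof -
  have "c \<noteq> []" using assms by auto
  then have ne: "hd c \<noteq> last c" using assms
    by (simp add: hd_conv_nth last_conv_nth nth_eq_iff_index_eq)
  have "odds (cycle_edges c) = sym_diff {last c, hd c} (odds (path_edges c))"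
    using odds_Un_disjoint[of "{{last c, hd c}}" "path_edges c"] cycle_closing_edge[OF assms]
      cycle_edges_path[OF \<open>c \<noteq> []\<close>] by (simp add: path_edges_finite)
  then show ?thesis using odds_path_edges[OF assms(2) \<open>c \<noteq> []\<close>] ne by auto
qed

lemma simple_cycle_edges:
  assumes "3 \<le> length c" "distinct c" shows "simple_edges (cycle_edges c)"
  unfolding simple_edges_def
proof safe
  fix e assume "e \<in> cycle_edges c"
  then obtain i where "i < length c" "e = {c ! i, c ! (Suc i mod length c)}" by (auto simp: cycle_edges_def)
  moreover have "i \<noteq> Suc i mod length c" "Suc i mod length c < length c"
    using assms \<open>i < length c\<close> by (auto simp: mod_Suc)
  ultimately show "card e = 2" using assms by (auto simp: nth_eq_iff_index_eq)
qed simp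

definition nth_edge :: "'a list \<Rightarrow> nat \<Rightarrow> 'a set" where
  "nth_edge c i = {c ! i, c ! (Suc i mod length c)}"

lemma cycle_edges_nth_edge: "cycle_edges c = nth_edge c ` {..<length c}"
  by (auto simp: cycle_edges_def nth_edge_def)

lemma nth_edge_in: "i < length c \<Longrightarrow> nth_edge c i \<in> cycle_edges c"
  by (auto simp: cycle_edges_nth_edge)

lemma nth_edge_inj:
  assumes "3 \<le> length c" "distinct c" "i < length c" "j < length c" "nth_edge c i = nth_edge c j"
  shows "i = j"
proof -
  have "inj_on (nth_edge c) {..<length c}"
    using card_cycle_edges[OF assms(1,2)] by (intro eq_card_imp_inj_on) (auto simp: cycle_edges_nth_edge)
  then show ?thesis using assms by (auto simp: inj_on_def)
qed

lemma cycle_edges_at: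
  assumes "3 \<le> length c" "distinct c" "Suc i < length c"
  shows "{e \<in> cycle_edges c. c ! Suc i \<in> e} = {nth_edge c i, nth_edge c (Suc i)}"
proof -
  have "c ! Suc i \<in> nth_edge c j \<longleftrightarrow> j = i \<or> j = Suc i" if "j < length c" for j
  proof -
    have "Suc j mod length c < length c" using assms by (intro mod_less_divisor) auto
    then have "c ! Suc i \<in> nth_edge c j \<longleftrightarrow> Suc i = j \<or> Suc i = Suc j mod length c"
      unfolding nth_edge_def using assms that by (simp add: nth_eq_iff_index_eq)
    then show ?thesis using that assms(3) by (cases "Suc j = length c") auto
  qed
  then show ?thesis using assms unfolding cycle_edges_nth_edge by auto
qed

lemma deg_cycle_nth:
  assumes "3 \<le> length c" "distinct c" "Suc i < length c"
  shows "deg (cycle_edges c) (c ! Suc i) = 2"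
  using cycle_edges_at[OF assms] nth_edge_inj[OF assms(1,2), of i "Suc i"] assms
  by (auto simp: deg_def card_insert_if)

text \<open>A vertex of degree 2 in E has only the two consecutive cycle edges, so an edge set that
  does not have degree 1 there contains both or none. This carries membership along a stretch of a
  cycle without branch vertices.\<close>

lemma cycle_propagate:
  assumes c: "3 \<le> length c" "distinct c" "Suc i < length c" and "finite E"
    and "cycle_edges c \<subseteq> E" "deg E (c ! Suc i) = 2" "Z \<subseteq> E" "deg Z (c ! Suc i) \<noteq> 1"
  shows "nth_edge c i \<in> Z \<longleftrightarrow> nth_edge c (Suc i) \<in> Z"
proof -
  let ?v = "c ! Suc i" and ?e = "nth_edge c i" and ?f = "nth_edge c (Suc i)"
  have ne: "?e \<noteq> ?f" using nth_edge_inj[OF c(1,2), of i "Suc i"] c by auto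
  have "{?e, ?f} \<subseteq> {e \<in> E. ?v \<in> e}" using cycle_edges_at[OF c] assms by blast
  moreover have "card {e \<in> E. ?v \<in> e} = 2" using assms by (simp add: deg_def)
  ultimately have E: "{e \<in> E. ?v \<in> e} = {?e, ?f}"
    using ne assms by (intro card_subset_eq[symmetric]) auto
  then have "{e \<in> Z. ?v \<in> e} = Z \<inter> {?e, ?f}" using assms by blast
  then have "card (Z \<inter> {?e, ?f}) \<noteq> 1" using assms by (simp add: deg_def)
  then show ?thesis by (cases "?e \<in> Z"; cases "?f \<in> Z") auto
qed

lemma circuit_nonempty: "circuit C \<Longrightarrow> C \<noteq> {}"
  unfolding circuit_def using card_cycle_edges by fastforce

lemma circuit_odds: "circuit C \<Longrightarrow> odds C = {}"
  unfolding circuit_def using odds_cycle_edges by blast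

lemma circuit_simple: "circuit C \<Longrightarrow> simple_edges C"
  unfolding circuit_def using simple_cycle_edges by blast

lemma even_deg_neq_1: "odds H = {} \<Longrightarrow> deg H v \<noteq> 1"
  unfolding odds_def by (metis (mono_tags, lifting) empty_Collect_eq odd_one)

text \<open>Inside C all vertices of the cycle have degree 2, so membership in Z propagates from one
  edge to all others.\<close>

lemma circuit_minimal:
  assumes "circuit C" "Z \<subseteq> C" "odds Z = {}" "Z \<noteq> {}"
  shows "Z = C"
proof -
  obtain c where c: "3 \<le> length c" "distinct c" "cycle_edges c = C" using assms by (auto simp: circuit_def)
  have step: "nth_edge c i \<in> Z \<longleftrightarrow> nth_edge c (Suc i) \<in> Z" if "Suc i < length c" for i
    using c that assms by (intro cycle_propagate[of c i C]) (auto simp: deg_cycle_nth even_deg_neq_1[OF assms(3), simplified])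
  have "nth_edge c i \<in> Z \<longleftrightarrow> nth_edge c 0 \<in> Z" if "i < length c" for i
    using that by (induction i) (auto simp: step[symmetric])
  then show ?thesis using assms c unfolding cycle_edges_nth_edge by blast
qed

text \<open>Removing an edge from an even set makes its two ends the only odd vertices, so they stay connected.\<close>

lemma even_edge_in_circuit:
  assumes "simple_edges H" "odds H = {}" "e \<in> H"
  shows "\<exists>C\<subseteq>H. circuit C \<and> e \<in> C"
proof -
  obtain u v where e: "e = {u, v}" "u \<noteq> v" using assms simple_edgesE by metis
  have "odds (H - {e}) = {u, v}"
    using odds_Diff[of H "{e}"] assms e by (auto simp: simple_edges_def)
  then have "conn (H - {e}) u v"
    using assms e simple_edges_subset[of H "H - {e}"] by (intro chain_imp_conn2) auto
  then obtain p where p: "p \<noteq> []" "hd p = u" "last p = v" "distinct p" "path_edges p \<subseteq> H - {e}"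
    using rtranclp_imp_path path_edges_subset_iff by metis
  have "length p \<noteq> 1" using p e by (cases p) auto
  moreover have "length p \<noteq> 2"
  proof
    assume "length p = 2"
    then obtain x y where "p = [x, y]" by (auto simp: length_Suc_conv numeral_2_eq_2)
    then show False using p e by (auto simp: path_edges_Cons)
  qed
  moreover have "length p \<noteq> 0" using p by simp
  ultimately have "3 \<le> length p" by linarith
  then show ?thesis using p e assms cycle_edges_path[OF p(1)]
    by (intro exI[of _ "cycle_edges p"]) (auto simp: circuit_def insert_commute)
qed

lemma even_imp_circuit:
  assumes "simple_edges H" "odds H = {}" "H \<noteq> {}"
  shows "\<exists>C\<subseteq>H. circuit C"
  using even_edge_in_circuit[OF assms(1,2)] assms(3) by blast

lemma conn_edge_imp_circuit:
  assumes "simple_edges E" "{u, v} \<in> E" "conn (E - {{u, v}}) u v"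
  shows "\<exists>C\<subseteq>E. circuit C \<and> {u, v} \<in> C"
proof -
  have ne: "u \<noteq> v" using simple_edges_neq assms by metis
  have "simple_edges (E - {{u, v}})" using assms(1) simple_edges_subset by blast
  then obtain R where R: "R \<subseteq> E - {{u, v}}" "odds R = {u, v}" using conn_imp_chain2 assms(3) ne by metis
  have "finite R" using R assms by (meson Diff_subset finite_subset simple_edges_def)
  then have "odds (R \<union> {{u, v}}) = {}" using odds_Un_disjoint[of R "{{u, v}}"] R by auto
  moreover have "R \<union> {{u, v}} \<subseteq> E" using R assms by auto
  moreover have "simple_edges (R \<union> {{u, v}})" using calculation assms simple_edges_subset by blast
  ultimately obtain C where "C \<subseteq> R \<union> {{u, v}}" "circuit C" "{u, v} \<in> C"
    using even_edge_in_circuit[of "R \<union> {{u, v}}" "{u, v}"] by auto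
  then show ?thesis using \<open>R \<union> {{u, v}} \<subseteq> E\<close> by blast
qed

lemma circuit_conn:
  assumes "circuit C" "{u, v} \<in> C"
  shows "conn (C - {{u, v}}) u v"
proof -
  have s: "simple_edges C" using assms circuit_simple by auto
  then have "u \<noteq> v" using simple_edges_neq assms by metis
  moreover have "odds (C - {{u, v}}) = {u, v}"
    using odds_Diff[of C "{{u, v}}"] assms s by (auto simp: simple_edges_def circuit_odds)
  ultimately show ?thesis using simple_edges_subset[OF s] by (intro chain_imp_conn2) auto
qed

lemma circuit_edges_conn:
  assumes "circuit C" "p \<in> \<Union>C" "q \<in> \<Union>C"
  shows "conn C p q"
proof -
  obtain c where c: "3 \<le> length c" "distinct c" "cycle_edges c = C" using assms by (auto simp: circuit_def)
  have "\<Union>C \<subseteq> set c" using c(1) unfolding c(3)[symmetric] cycle_edges_def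
    by (auto intro!: nth_mem mod_less_divisor)
  moreover have "conn C (c ! 0) (c ! i)" if "i < length c" for i
    using that
  proof (induction i)
    case (Suc i)
    have "{c ! i, c ! Suc i} \<in> C" using Suc c nth_edge_in[of i c] by (auto simp: nth_edge_def)
    then show ?case using Suc by (meson Suc_lessD rtranclp.rtrancl_into_rtrancl)
  qed simp
  ultimately have "conn C (c ! 0) p" "conn C (c ! 0) q" using assms by (metis in_set_conv_nth subsetD)+
  then show ?thesis using conn_sym conn_trans by metis
qed

section \<open>Circuit elimination, trees and edge cuts\<close>

text \<open>Consider the circuits D1 through e and D2 through h in the symmetric difference. If they
  cannot be taken equal, replacing C2 by D2 loses an edge of D1 that lies in C2 only.\<close>

lemma circuit_union:
  assumes "circuit C1" "circuit C2" "e \<in> C1" "h \<in> C2" "C1 \<inter> C2 \<noteq> {}"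
  shows "\<exists>C\<subseteq>C1 \<union> C2. circuit C \<and> e \<in> C \<and> h \<in> C"
  using assms
proof (induction "card (C1 \<union> C2)" arbitrary: C1 C2 rule: less_induct)
  case less
  show ?case
  proof (cases "e \<in> C2 \<or> h \<in> C1")
    case True
    then show ?thesis using less.prems by blast
  next
    case False
    have s: "simple_edges C1" "simple_edges C2" using less.prems circuit_simple by auto
    let ?S = "sym_diff C1 C2"
    have "simple_edges (C1 \<union> C2)" using s by (auto simp: simple_edges_def)
    then have sS: "simple_edges ?S" by (rule simple_edges_subset) blast
    have fin: "finite C1" "finite C2" using s by (auto simp: simple_edges_def)
    have oS: "odds ?S = {}" using odds_sym_diff[OF fin] less.prems by (simp add: circuit_odds)
    obtain D1 where D1: "D1 \<subseteq> ?S" "circuit D1" "e \<in> D1"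
      using even_edge_in_circuit[OF sS oS, of e] False less.prems by blast
    show ?thesis
    proof (cases "h \<in> D1")
      case True
      then show ?thesis using D1 by blast
    next
      case h: False
      have "odds (?S - D1) = {}"
        using odds_Diff[of ?S D1] D1 oS fin by (simp add: circuit_odds)
      moreover have "simple_edges (?S - D1)" by (rule simple_edges_subset[OF sS]) blast
      ultimately obtain D2 where D2: "D2 \<subseteq> ?S - D1" "circuit D2" "h \<in> D2"
        using even_edge_in_circuit[of "?S - D1" h] False less.prems h by blast
      obtain f where f: "f \<in> C1" "f \<in> C2" using less.prems by blast
      \<comment> \<open>Otherwise D2 = C2 by minimality, although D2 avoids the common edge f. So D2
        has an edge of C1, and the pair C1, D2 still meets.\<close>
      have "\<not> D2 \<subseteq> C2"
      proof
        assume "D2 \<subseteq> C2"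
        from circuit_minimal[OF less.prems(2) this circuit_odds[OF D2(2)] circuit_nonempty[OF D2(2)]]
        show False using D2(1) f by auto
      qed
      then have meet: "C1 \<inter> D2 \<noteq> {}" using D2 by blast
      \<comment> \<open>In the same way D1 has an edge x of C2 outside C1. As D2 is disjoint from
        D1, x is lost and the union shrinks.\<close>
      have "\<not> D1 \<subseteq> C1"
      proof
        assume "D1 \<subseteq> C1"
        from circuit_minimal[OF less.prems(1) this circuit_odds[OF D1(2)] circuit_nonempty[OF D1(2)]]
        show False using D1(1) f by auto
      qed
      then obtain x where x: "x \<in> D1" "x \<notin> C1" "x \<in> C2" using D1 by blast
      have "C1 \<union> D2 \<subset> C1 \<union> C2" using D2 x by blast
      then have "card (C1 \<union> D2) < card (C1 \<union> C2)" using fin by (intro psubset_card_mono) auto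
      then obtain C where "C \<subseteq> C1 \<union> D2" "circuit C" "e \<in> C" "h \<in> C"
        using less.hyps[of C1 D2] less.prems D2 meet by blast
      then show ?thesis using D2 by blast
    qed
  qed
qed

section \<open>Edge counts of forests and of connected graphs\<close>

text \<open>\<open>odds\<close> is injective on the subsets of an acyclic X, because a nonempty even
  symmetric difference would contain a circuit. Comparing numbers of subsets gives the
  bound.\<close>

lemma acyclic_card_le:
  assumes "simple_edges X" "\<And>C. C \<subseteq> X \<Longrightarrow> \<not> circuit C"
  shows "card X \<le> card (\<Union>X)"
proof -
  have fX: "finite X" using assms(1) by (rule simple_edges_finite)
  have "inj_on odds (Pow X)"
  proof (rule inj_onI)
    fix A B assume AB: "A \<in> Pow X" "B \<in> Pow X" "odds A = odds B"
    have "finite A" "finite B" using AB fX finite_subset by auto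
    then have "odds (sym_diff A B) = {}" using odds_sym_diff[of A B] AB(3) by simp
    moreover have "sym_diff A B \<subseteq> X" using AB by auto
    moreover have "simple_edges (sym_diff A B)" by (rule simple_edges_subset[OF assms(1)]) (use AB in auto)
    ultimately have "sym_diff A B = {}" using even_imp_circuit[of "sym_diff A B"] assms(2) subset_trans by metis
    then show "A = B" by blast
  qed
  moreover have "odds ` Pow X \<subseteq> Pow (\<Union>X)"
  proof (intro image_subsetI PowI)
    fix A assume "A \<in> Pow X"
    then have "\<Union>A \<subseteq> \<Union>X" by (intro Union_mono) simp
    then show "odds A \<subseteq> \<Union>X" using odds_subset_Union by (rule subset_trans[rotated])
  qed
  moreover have "finite (Pow (\<Union>X))" using simple_edges_finite_Union[OF assms(1)] by simp
  ultimately have "card (Pow X) \<le> card (Pow (\<Union>X))" by (meson card_inj_on_le)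
  then have "(2::nat) ^ card X \<le> 2 ^ card (\<Union>X)"
    using fX simple_edges_finite_Union[OF assms(1)] by (simp add: card_Pow)
  then show ?thesis by simp
qed

text \<open>The same count in the other direction: every subset of U without the root r is, up to r
  and vertices outside U, the boundary of a subset of X, since a chain from r to z toggles only r
  and z.\<close>

lemma connected_card_le:
  assumes "simple_edges X" "finite U" "\<And>p q. p \<in> U \<Longrightarrow> q \<in> U \<Longrightarrow> conn X p q"
  shows "card U \<le> card X + 1"
proof (cases "U = {}")
  case False
  then obtain r where r: "r \<in> U" by blast
  define f where "f R = odds R \<inter> (U - {r})" for R :: "'a set set"
  have "Z \<in> f ` Pow X" if "Z \<subseteq> U - {r}" for Z
  proof -
    have "finite Z" using that assms(2) finite_subset by auto
    then have "\<exists>R\<subseteq>X. odds R - {r} = Z" using that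
    proof (induction Z rule: finite_induct)
      case empty then show ?case by (intro exI[of _ "{}"]) auto
    next
      case (insert z Z)
      then obtain R where R: "R \<subseteq> X" "odds R - {r} = Z" by auto
      obtain P where P: "P \<subseteq> X" "odds P = {r, z}"
        using conn_imp_chain2[OF assms(1) assms(3)[OF r, of z]] insert by auto
      have "finite R" "finite P" using R P assms(1) simple_edges_finite finite_subset by metis+
      then have "odds (sym_diff R P) - {r} = insert z Z"
        using odds_sym_diff[of R P] R P insert by auto
      moreover have "sym_diff R P \<subseteq> X" using R P by blast
      ultimately show ?case by blast
    qed
    then obtain R where "R \<subseteq> X" "odds R - {r} = Z" by blast
    then have "f R = Z" using that unfolding f_def by blast
    then show ?thesis using \<open>R \<subseteq> X\<close> by blast
  qed
  then have "Pow (U - {r}) \<subseteq> f ` Pow X" by blast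
  then have "card (Pow (U - {r})) \<le> card (Pow X)"
    using simple_edges_finite[OF assms(1)] by (meson surj_card_le finite_Pow_iff)
  then have "(2::nat) ^ card (U - {r}) \<le> 2 ^ card X"
    using simple_edges_finite[OF assms(1)] assms(2) by (simp add: card_Pow)
  then have "card (U - {r}) \<le> card X" by simp
  then show ?thesis using r assms(2) by simp
qed simp

lemma spanning_tree:
  assumes "simple_edges B" "\<And>p q. p \<in> \<Union>B \<Longrightarrow> q \<in> \<Union>B \<Longrightarrow> conn B p q"
  shows "\<exists>T\<subseteq>B. (\<forall>C\<subseteq>T. \<not> circuit C) \<and> card (\<Union>B) \<le> card T + 1"
proof -
  define sp where "sp T \<longleftrightarrow> T \<subseteq> B \<and> (\<forall>p\<in>\<Union>B. \<forall>q\<in>\<Union>B. conn T p q)" for T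
  have "sp B" using assms(2) by (auto simp: sp_def)
  \<comment> \<open>A smallest subset that still connects all vertices of B; any edge on a circuit
    of T could be omitted.\<close>
  then obtain T where T: "sp T" "\<And>S. sp S \<Longrightarrow> card T \<le> card S"
    using exists_least_iff[of "\<lambda>n. \<exists>T. sp T \<and> card T = n"] by (metis leI)
  have fT: "finite T" using T assms(1) simple_edges_finite finite_subset unfolding sp_def by metis
  have "\<not> circuit C" if "C \<subseteq> T" for C
  proof
    assume C: "circuit C"
    then obtain e where e: "e \<in> C" using circuit_nonempty by blast
    obtain u v where uv: "e = {u, v}" using simple_edgesE[OF circuit_simple[OF C] e] by metis
    have uvc: "conn (T - {e}) u v"
      using circuit_conn[OF C] e uv that conn_mono[of "C - {{u, v}}" "T - {e}"] by blast
    have "conn (T - {e}) x y" if "{x, y} \<in> T" for x y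
    proof (cases "{x, y} = e")
      case True
      then have "(x = u \<and> y = v) \<or> (x = v \<and> y = u)" using uv by (auto simp: doubleton_eq_iff)
      then show ?thesis using uvc conn_sym[OF uvc] by blast
    next
      case False
      then show ?thesis using that by blast
    qed
    then have edge: "{x, y} \<in> T \<Longrightarrow> conn (T - {e}) x y" for x y .
    have *: "conn (T - {e}) p q" if "conn T p q" for p q
      using that
    proof (induction rule: rtranclp_induct)
      case (step y z)
      then show ?case using conn_trans[OF step.IH edge[of y z]] by blast
    qed simp
    have "sp (T - {e})" using T(1) * unfolding sp_def by blast
    then have "card T \<le> card (T - {e})" by (rule T(2))
    then show False using e that fT card_Diff1_less[of T e] by (meson not_less subsetD)
  qed
  moreover have "card (\<Union>B) \<le> card T + 1"
  proof (rule connected_card_le)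
    show "simple_edges T" by (rule simple_edges_subset[OF assms(1)]) (use T(1) sp_def in auto)
    show "finite (\<Union>B)" using assms(1) by (rule simple_edges_finite_Union)
    show "conn T p q" if "p \<in> \<Union>B" "q \<in> \<Union>B" for p q using T(1) that by (auto simp: sp_def)
  qed
  ultimately show ?thesis using T(1) unfolding sp_def by blast
qed

section \<open>Flows with unit capacities and edge cuts\<close>

lemma rtranclp_closed:
  assumes "r\<^sup>*\<^sup>* s v" "s \<in> V" "\<And>a b. a \<in> V \<Longrightarrow> r a b \<Longrightarrow> b \<in> V"
  shows "v \<in> V"
  using assms(1) by (induction rule: rtranclp_induct) (auto simp: assms)

text \<open>The net outflow at v of the flow that sends one unit along every arc of A.\<close>

definition bal :: "('a \<times> 'a) set \<Rightarrow> 'a \<Rightarrow> int" where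
  "bal A v = int (card {w. (v, w) \<in> A}) - int (card {w. (w, v) \<in> A})"

lemma finite_out: "finite A \<Longrightarrow> finite {w. (v, w) \<in> A}" and finite_in: "finite A \<Longrightarrow> finite {w. (w, v) \<in> A}"
  by (rule finite_subset[of _ "snd ` A"]; force) (rule finite_subset[of _ "fst ` A"]; force)

lemma bal_Un:
  assumes "finite A" "finite B" "A \<inter> B = {}"
  shows "bal (A \<union> B) v = bal A v + bal B v"
proof -
  have "{w. (v, w) \<in> A \<union> B} = {w. (v, w) \<in> A} \<union> {w. (v, w) \<in> B}"
    "{w. (w, v) \<in> A \<union> B} = {w. (w, v) \<in> A} \<union> {w. (w, v) \<in> B}" by auto
  moreover have "{w. (v, w) \<in> A} \<inter> {w. (v, w) \<in> B} = {}" "{w. (w, v) \<in> A} \<inter> {w. (w, v) \<in> B} = {}"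
    using assms(3) by auto
  ultimately show ?thesis unfolding bal_def using finite_out[OF assms(1)] finite_out[OF assms(2)]
      finite_in[OF assms(1)] finite_in[OF assms(2)] by (simp add: card_Un_disjoint)
qed

lemma bal_Diff:
  assumes "finite A" "B \<subseteq> A"
  shows "bal (A - B) v = bal A v - bal B v"
proof -
  have "finite B" using assms finite_subset by auto
  then have "bal ((A - B) \<union> B) v = bal (A - B) v + bal B v" using assms by (intro bal_Un) auto
  then show ?thesis using assms by (simp add: Un_absorb2)
qed

lemma bal_converse: "bal (A\<inverse>) v = - bal A v"
  by (simp add: bal_def)

text \<open>Arcs with both ends in R cancel.\<close>

lemma bal_sum:
  assumes "finite A" "finite R"
  shows "(\<Sum>v\<in>R. bal A v) = int (card {(a, b) \<in> A. a \<in> R \<and> b \<notin> R}) - int (card {(a, b) \<in> A. a \<notin> R \<and> b \<in> R})"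
  using assms(1)
proof (induction A rule: finite_induct)
  case empty then show ?case by (simp add: bal_def)
next
  case (insert x A)
  obtain a b where x: "x = (a, b)" by (cases x)
  have o: "{w. (v, w) \<in> {(a, b)}} = (if v = a then {b} else {})"
    "{w. (w, v) \<in> {(a, b)}} = (if v = b then {a} else {})" for v by auto
  have b1: "bal {(a, b)} v = (if v = a then 1 else 0) - (if v = b then 1 else 0)" for v
    unfolding bal_def o by auto
  have "bal (insert x A) v = bal {(a, b)} v + bal A v" for v
    using bal_Un[of "{x}" A v] insert x by simp
  then have "(\<Sum>v\<in>R. bal (insert x A) v) = (\<Sum>v\<in>R. bal {(a, b)} v) + (\<Sum>v\<in>R. bal A v)"
    by (simp add: sum.distrib)
  also have "(\<Sum>v\<in>R. bal {(a, b)} v) = (if a \<in> R then 1 else 0) - (if b \<in> R then 1 else 0)"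
    unfolding b1 using assms(2) by (simp add: sum_subtractf sum.delta)
  moreover have "{(a, b) \<in> insert x A. a \<in> R \<and> b \<notin> R} =
      (if a \<in> R \<and> b \<notin> R then insert x {(a, b) \<in> A. a \<in> R \<and> b \<notin> R} else {(a, b) \<in> A. a \<in> R \<and> b \<notin> R})"
    "{(a, b) \<in> insert x A. a \<notin> R \<and> b \<in> R} =
      (if a \<notin> R \<and> b \<in> R then insert x {(a, b) \<in> A. a \<notin> R \<and> b \<in> R} else {(a, b) \<in> A. a \<notin> R \<and> b \<in> R})"
    using x by auto
  moreover have "finite {(a, b) \<in> A. a \<in> R \<and> b \<notin> R}" "finite {(a, b) \<in> A. a \<notin> R \<and> b \<in> R}"
    using insert(1) by (auto intro: finite_subset[of _ A])
  moreover have "x \<notin> {(a, b) \<in> A. a \<in> R \<and> b \<notin> R}" "x \<notin> {(a, b) \<in> A. a \<notin> R \<and> b \<in> R}"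
    using insert(2) by auto
  ultimately show ?case using insert(3) by (cases "a \<in> R"; cases "b \<in> R") simp_all
qed

definition path_arcs :: "'a list \<Rightarrow> ('a \<times> 'a) set" where
  "path_arcs p = set (zip p (tl p))"

lemma path_arcs_simps [simp]: "path_arcs [] = {}" "path_arcs [x] = {}"
    "path_arcs (x # y # p) = insert (x, y) (path_arcs (y # p))"
  by (auto simp: path_arcs_def)

lemma path_arcs_fields: "path_arcs p \<subseteq> set p \<times> set p"
  by (induction p rule: induct_list012) auto

lemma finite_path_arcs [simp]: "finite (path_arcs p)"
  by (simp add: path_arcs_def)

lemma path_arcs_subset: "successively (\<lambda>a b. Q a b) p \<Longrightarrow> (a, b) \<in> path_arcs p \<Longrightarrow> Q a b"
  by (induction p rule: induct_list012) auto

lemma path_arcs_antisym: "distinct p \<Longrightarrow> (a, b) \<in> path_arcs p \<Longrightarrow> (b, a) \<notin> path_arcs p"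
proof (induction p rule: induct_list012)
  case (3 x y p)
  then show ?case using path_arcs_fields[of "y # p"] by auto
qed auto

lemma path_edges_arcs: "path_edges p = (\<lambda>(a, b). {a, b}) ` path_arcs p"
  by (induction p rule: induct_list012) (auto simp: path_edges_Cons)

lemma bal_path_arcs:
  "distinct p \<Longrightarrow> p \<noteq> [] \<Longrightarrow> bal (path_arcs p) v = of_bool (v = hd p) - of_bool (v = last p)"
proof (induction p rule: induct_list012)
  case (3 x y p)
  have "(x, y) \<notin> path_arcs (y # p)" using 3 path_arcs_fields[of "y # p"] by auto
  then have "bal (insert (x, y) (path_arcs (y # p))) v = bal {(x, y)} v + bal (path_arcs (y # p)) v"
    using bal_Un[of "{(x, y)}" "path_arcs (y # p)" v] by simp
  moreover have "{w. (v, w) \<in> {(x, y)}} = (if v = x then {y} else {})"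
    "{w. (w, v) \<in> {(x, y)}} = (if v = y then {x} else {})" by auto
  then have "bal {(x, y)} v = of_bool (v = x) - of_bool (v = y)" unfolding bal_def by auto
  ultimately show ?case using 3 by auto
qed (auto simp: bal_def)

text \<open>Take a maximal integral flow and a path carried by it: the path costs one unit of flow.\<close>

lemma removable_path:
  assumes B: "simple_edges B" and st: "s \<noteq> t" "conn B s t"
  shows "\<exists>P\<subseteq>B. conn P s t \<and> (\<forall>S. \<not> conn (B - P - S) s t \<longrightarrow>
           (\<exists>S'\<subseteq>B. \<not> conn (B - S') s t \<and> card S' \<le> card (S \<inter> B) + 1))"
proof -
  \<comment> \<open>An undirected edge has capacity one in total, so a flow must not use both of its
    orientations.\<close>
  define flow where "flow A n \<longleftrightarrow> (\<forall>a b. (a, b) \<in> A \<longrightarrow> {a, b} \<in> B \<and> (b, a) \<notin> A) \<and>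
      (\<forall>v. bal A v = int n * (of_bool (v = s) - of_bool (v = t)))" for A n
  let ?V = "\<Union>B"
  have fV: "finite ?V" using B by (rule simple_edges_finite_Union)
  have fB: "finite B" using B by (rule simple_edges_finite)
  have AV: "A \<subseteq> ?V \<times> ?V" if "\<And>a b. (a, b) \<in> A \<Longrightarrow> {a, b} \<in> B" for A
    using that by fast
  have fA: "finite A" if "flow A n" for A n
    using AV[of A] that fV finite_subset unfolding flow_def by (metis finite_cartesian_product)
  have sV: "s \<in> ?V" "t \<in> ?V"
  proof -
    show "s \<in> ?V" using st(2) by (rule converse_rtranclpE) (use st(1) in auto)
    show "t \<in> ?V" using conn_sym[OF st(2)] by (rule converse_rtranclpE) (use st(1) in auto)
  qed
  have val: "int n = int (card {(a, b) \<in> A. a \<in> R \<and> b \<notin> R}) - int (card {(a, b) \<in> A. a \<notin> R \<and> b \<in> R})"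
    if "flow A n" "s \<in> R" "t \<notin> R" "R \<subseteq> ?V" for A n R
  proof -
    have fR: "finite R" using that fV finite_subset by auto
    have "(\<Sum>v\<in>R. bal A v) = (\<Sum>v\<in>R. int n * of_bool (v = s))"
      using that by (intro sum.cong) (auto simp: flow_def)
    also have "\<dots> = int n" using that fR by (simp add: of_bool_def sum.delta flip: sum_distrib_left)
    finally show ?thesis using bal_sum[OF fA[OF that(1)] fR] by simp
  qed
  have bound: "n \<le> card (?V \<times> ?V)" if "flow A n" for A n
  proof -
    have "{s} \<subseteq> ?V" using sV by simp
    then have "int n \<le> int (card {(a, b) \<in> A. a \<in> {s} \<and> b \<notin> {s}})"
      using val[OF that, of "{s}"] st(1) by simp
    also have "\<dots> \<le> int (card (?V \<times> ?V))"
      using AV[of A] that fV unfolding flow_def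
      by (intro zle_int[THEN iffD2] card_mono) (auto intro: finite_cartesian_product)
    finally show ?thesis by simp
  qed
  have "flow {} 0" by (auto simp: flow_def bal_def)
  then have ex: "\<exists>n. (\<exists>A. flow A n)" by blast
  define n where "n = (GREATEST n. \<exists>A. flow A n)"
  have "\<exists>A. flow A n" unfolding n_def using GreatestI_ex_nat[of "\<lambda>n. \<exists>A. flow A n"] ex bound by blast
  then obtain A where A: "flow A n" by blast
  have nmax: "m \<le> n" if "flow A' m" for A' m
    unfolding n_def using that bound by (intro Greatest_le_nat) blast+
  have Aprop: "{a, b} \<in> B" "(b, a) \<notin> A" if "(a, b) \<in> A" for a b using A that by (auto simp: flow_def)
  \<comment> \<open>The residual graph: an edge that carries flow can only be traversed against it,
    any other edge in both directions.\<close>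
  define res where "res a b \<longleftrightarrow> {a, b} \<in> B \<and> (a, b) \<notin> A" for a b
  have "\<not> res\<^sup>*\<^sup>* s t"
  proof
    assume "res\<^sup>*\<^sup>* s t"
    then obtain p where p: "p \<noteq> []" "hd p = s" "last p = t" "distinct p" "successively res p"
      using rtranclp_imp_path by metis
    define X where "X = path_arcs p"
    have X: "{a, b} \<in> B" "(a, b) \<notin> A" "(b, a) \<notin> X" if "(a, b) \<in> X" for a b
      using path_arcs_subset[OF p(5)] path_arcs_antisym[OF p(4)] that unfolding X_def res_def by blast+
    \<comment> \<open>For the augmenting path, \<open>X2\<close> consists of the flow arcs cancelled
      because the path runs against them, \<open>X1\<close> of the arcs newly used.\<close>
    define X1 where "X1 = X - A\<inverse>"
    define X2 where "X2 = A \<inter> X\<inverse>"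
    define A' where "A' = (A - X2) \<union> X1"
    have fin: "finite X" "finite A" "finite X1" "finite X2" "finite (A - X2)"
      using fA[OF A] by (auto simp: X_def X1_def X2_def)
    have "X = X1 \<union> X2\<inverse>" "X1 \<inter> X2\<inverse> = {}" unfolding X1_def X2_def by auto
    then have balX: "bal X v = bal X1 v - bal X2 v" for v
      using bal_Un[of X1 "X2\<inverse>" v] fin bal_converse[of X2 v] by simp
    have "(A - X2) \<inter> X1 = {}" using X unfolding X1_def by auto
    then have "bal A' v = bal A v + bal X v" for v unfolding A'_def
      using bal_Un[of "A - X2" X1 v] fin balX[of v] bal_Diff[of A X2 v] by (simp add: X2_def)
    moreover have "bal X v = of_bool (v = s) - of_bool (v = t)" for v
      using bal_path_arcs[OF p(4,1), of v] p unfolding X_def by simp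
    ultimately have "bal A' v = int (Suc n) * (of_bool (v = s) - of_bool (v = t))" for v
      using A unfolding flow_def by (simp add: algebra_simps)
    moreover have "{a, b} \<in> B \<and> (b, a) \<notin> A'" if "(a, b) \<in> A'" for a b
      using that X Aprop unfolding A'_def X1_def X2_def by (auto simp: insert_commute)
    ultimately have "flow A' (Suc n)" unfolding flow_def by blast
    then show False using nmax by fastforce
  qed
  \<comment> \<open>Every edge leaving the set reachable in the residual graph carries flow
    outwards, and no flow enters the set; so the cut \<open>S0\<close> has at most n edges.\<close>
  define R where "R = {v. res\<^sup>*\<^sup>* s v}"
  have R: "s \<in> R" "t \<notin> R" using \<open>\<not> res\<^sup>*\<^sup>* s t\<close> by (auto simp: R_def)
  have RV: "R \<subseteq> ?V"
  proof
    fix v assume "v \<in> R"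
    then have "res\<^sup>*\<^sup>* s v" by (simp add: R_def)
    then show "v \<in> ?V" by (cases rule: rtranclp.cases) (use sV res_def in auto)
  qed
  define S0 where "S0 = {e \<in> B. \<exists>a b. e = {a, b} \<and> a \<in> R \<and> b \<notin> R}"
  have cut: "v \<in> R" if "conn (B - S0) s v" for v
    using that
  proof (induction rule: rtranclp_induct)
    case (step y z)
    then have yz: "{y, z} \<in> B" "{y, z} \<notin> S0" "y \<in> R" by simp_all
    show ?case
    proof (rule ccontr)
      assume "z \<notin> R"
      then have "\<exists>a b. {y, z} = {a, b} \<and> a \<in> R \<and> b \<notin> R" using yz by (intro exI[of _ y] exI[of _ z]) simp
      then show False using yz unfolding S0_def by simp
    qed
  qed (use R in simp)
  have S0B: "S0 \<subseteq> B" by (auto simp: S0_def)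
  have S0c: "\<not> conn (B - S0) s t" using cut[of t] R(2) by blast
  note S0 = S0B S0c
  have out: "(a, b) \<in> A" if "{a, b} \<in> B" "a \<in> R" "b \<notin> R" for a b
    using that unfolding R_def res_def by (auto intro: rtranclp.rtrancl_into_rtrancl)
  have "{(a, b) \<in> A. a \<notin> R \<and> b \<in> R} = {}"
  proof -
    have False if "(a, b) \<in> A" "a \<notin> R" "b \<in> R" for a b
    proof -
      have "{b, a} \<in> B" using Aprop(1)[OF that(1)] by (simp add: insert_commute)
      then show False using out[of b a] that Aprop(2)[OF that(1)] by simp
    qed
    then show ?thesis by auto
  qed
  then have "card {(a, b) \<in> A. a \<notin> R \<and> b \<in> R} = 0" by (simp only: card.empty)
  then have nval: "n = card {(a, b) \<in> A. a \<in> R \<and> b \<notin> R}" using val[OF A R RV] by linarith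
  have "S0 \<subseteq> (\<lambda>(a, b). {a, b}) ` {(a, b) \<in> A. a \<in> R \<and> b \<notin> R}"
  proof
    fix e assume "e \<in> S0"
    then obtain a b where ab: "e = {a, b}" "e \<in> B" "a \<in> R" "b \<notin> R" by (auto simp: S0_def)
    then have "(a, b) \<in> {(a, b) \<in> A. a \<in> R \<and> b \<notin> R}" using out[of a b] by simp
    then show "e \<in> (\<lambda>(a, b). {a, b}) ` {(a, b) \<in> A. a \<in> R \<and> b \<notin> R}"
      by (rule image_eqI[rotated]) (simp add: ab(1))
  qed
  note S0out = this
  have "finite {(a, b) \<in> A. a \<in> R \<and> b \<notin> R}" by (rule finite_subset[OF _ fA[OF A]]) auto
  then have S0n: "card S0 \<le> n" unfolding nval by (rule surj_card_le[OF _ S0out])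
  have "S0 \<noteq> {}"
  proof
    assume "S0 = {}"
    then show False using S0c st(2) by simp
  qed
  then have "0 < card S0" using finite_subset[OF S0B fB] by (simp add: card_gt_0_iff)
  then have "0 < n" using S0n by linarith
  \<comment> \<open>Otherwise no flow arc would leave the set reachable along flow arcs, although n
    > 0 units have to.\<close>
  have "(\<lambda>a b. (a, b) \<in> A)\<^sup>*\<^sup>* s t"
  proof (rule ccontr)
    assume no: "\<not> ?thesis"
    define Q where "Q = {v. (\<lambda>a b. (a, b) \<in> A)\<^sup>*\<^sup>* s v}"
    have step: "b \<in> Q" if "a \<in> Q" "(a, b) \<in> A" for a b
      using that rtranclp.rtrancl_into_rtrancl[of "\<lambda>a b. (a, b) \<in> A" s a b] by (simp add: Q_def)
    have "Q \<subseteq> ?V"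
    proof
      fix v assume "v \<in> Q"
      then have "(\<lambda>a b. (a, b) \<in> A)\<^sup>*\<^sup>* s v" by (simp add: Q_def)
      then show "v \<in> ?V" by (rule rtranclp_closed) (use sV Aprop in blast)+
    qed
    moreover have "{(a, b) \<in> A. a \<in> Q \<and> b \<notin> Q} = {}" using step by auto
    then have "card {(a, b) \<in> A. a \<in> Q \<and> b \<notin> Q} = 0" by (simp only: card.empty)
    moreover have "s \<in> Q" "t \<notin> Q" using no by (simp_all add: Q_def)
    ultimately show False using val[OF A, of Q] \<open>0 < n\<close> by linarith
  qed
  then obtain p where p: "p \<noteq> []" "hd p = s" "last p = t" "distinct p" "successively (\<lambda>a b. (a, b) \<in> A) p"
    using rtranclp_imp_path by metis
  have XA: "path_arcs p \<subseteq> A" using path_arcs_subset[OF p(5)] by auto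
  define A2 where "A2 = A - path_arcs p"
  define P where "P = path_edges p"
  have "bal A2 v = int (n - 1) * (of_bool (v = s) - of_bool (v = t))" for v
    using bal_Diff[OF fA[OF A] XA, of v] bal_path_arcs[OF p(4,1), of v] p A \<open>0 < n\<close>
    unfolding A2_def flow_def by (simp add: of_nat_diff algebra_simps)
  then have A2: "flow A2 (n - 1)" using Aprop unfolding flow_def A2_def by blast
  have PB: "P \<subseteq> B" unfolding P_def path_edges_arcs using XA Aprop by auto
  have "conn P s t" using path_imp_rtranclp[of p "\<lambda>u v. {u, v} \<in> P"] p path_edges_subset_iff[of p P]
    unfolding P_def by simp
  moreover have "\<exists>S'\<subseteq>B. \<not> conn (B - S') s t \<and> card S' \<le> card (S \<inter> B) + 1" if "\<not> conn (B - P - S) s t" for S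
  proof -
    \<comment> \<open>A flow of value n - 1 survives the removal of P, and each of its arcs out of Q
      uses its own edge of S. So n - 1 is at most \<open>card (S \<inter> B)\<close>, and the cut
      \<open>S0\<close> serves as \<open>S'\<close>.\<close>
    define Q where "Q = {v. conn (B - P - S) s v}"
    have step: "b \<in> Q" if "a \<in> Q" "{a, b} \<in> B - P - S" for a b
      using that(1) rtranclp.rtrancl_into_rtrancl[of "\<lambda>a b. {a, b} \<in> B - P - S" s a b, OF _ that(2)]
      unfolding Q_def mem_Collect_eq by blast
    have "Q \<subseteq> ?V"
    proof
      fix v assume "v \<in> Q"
      then have "conn (B - P - S) s v" by (simp only: Q_def mem_Collect_eq)
      then show "v \<in> ?V" by (rule rtranclp_closed) (use sV in blast)+
    qed
    moreover have "s \<in> Q" "t \<notin> Q" using that by (simp_all only: Q_def mem_Collect_eq rtranclp.rtrancl_refl not_False_eq_True)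
    ultimately have "int (n - 1) \<le> int (card {(a, b) \<in> A2. a \<in> Q \<and> b \<notin> Q})"
      using val[OF A2, of Q] by linarith
    moreover have "card {(a, b) \<in> A2. a \<in> Q \<and> b \<notin> Q} \<le> card (S \<inter> B)"
    proof (rule card_inj_on_le[where f="\<lambda>(a, b). {a, b}"])
      show "inj_on (\<lambda>(a, b). {a, b}) {(a, b) \<in> A2. a \<in> Q \<and> b \<notin> Q}"
        by (auto simp: inj_on_def doubleton_eq_iff)
      have "{a, b} \<in> S" if ab: "(a, b) \<in> A2" "a \<in> Q" "b \<notin> Q" for a b
      proof (rule ccontr)
        assume "{a, b} \<notin> S"
        moreover have "{a, b} \<in> B" using ab Aprop by (auto simp: A2_def)
        \<comment> \<open>In A an edge of P carries only the arc of the path, which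
          \<open>A2\<close> has lost; the opposite arc is excluded in a flow.\<close>
        moreover have "{a, b} \<notin> P"
        proof
          assume "{a, b} \<in> P"
          then obtain c d where "(c, d) \<in> path_arcs p" "{a, b} = {c, d}"
            unfolding P_def path_edges_arcs by auto
          then show False using ab XA Aprop unfolding A2_def by (auto simp: doubleton_eq_iff)
        qed
        ultimately have "{a, b} \<in> B - P - S" by blast
        then show False using step[OF ab(2)] ab(3) by blast
      qed
      moreover have "{a, b} \<in> B" if "(a, b) \<in> A2" for a b using that Aprop by (auto simp: A2_def)
      ultimately show "(\<lambda>(a, b). {a, b}) ` {(a, b) \<in> A2. a \<in> Q \<and> b \<notin> Q} \<subseteq> S \<inter> B" by auto
      show "finite (S \<inter> B)" using fB by simp
    qed
    ultimately have "n \<le> card (S \<inter> B) + 1" by linarith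
    then show ?thesis using S0 S0n by (meson le_trans)
  qed
  ultimately show ?thesis using PB by blast
qed

section \<open>Cycles with few branch vertices\<close>

definition branch :: "'a set set \<Rightarrow> 'a set" where
  "branch E = {v. 3 \<le> deg E v}"

text \<open>The 2-core, obtained as a largest edge set rather than by pruning pendant edges, so that
  even sets lie in it at once.\<close>

definition core :: "'a set set \<Rightarrow> 'a set set" where
  "core E = \<Union>{F. F \<subseteq> E \<and> (\<forall>v. deg F v \<noteq> 1)}"

lemma core_subset: "core E \<subseteq> E"
  by (auto simp: core_def)

lemma subset_core: "F \<subseteq> E \<Longrightarrow> (\<And>v. deg F v \<noteq> 1) \<Longrightarrow> F \<subseteq> core E"
  by (auto simp: core_def)

lemma even_subset_core: "F \<subseteq> E \<Longrightarrow> odds F = {} \<Longrightarrow> F \<subseteq> core E"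
  using subset_core even_deg_neq_1 by metis

text \<open>A sole edge at v in the union would also be the sole edge at v in the member that
  contributes it.\<close>

lemma deg_core:
  assumes "finite E" shows "deg (core E) v \<noteq> 1"
proof
  assume "deg (core E) v = 1"
  then obtain e where e: "{x \<in> core E. v \<in> x} = {e}" unfolding deg_def by (rule card_1_singletonE)
  then have "e \<in> core E" "v \<in> e" by auto
  then obtain F where F: "F \<subseteq> E" "\<forall>v. deg F v \<noteq> 1" "e \<in> F" by (auto simp: core_def)
  then have "F \<subseteq> core E" by (intro subset_core) auto
  then have "{x \<in> F. v \<in> x} \<subseteq> {x \<in> core E. v \<in> x}" by blast
  then have "{x \<in> F. v \<in> x} \<subseteq> {e}" by (simp only: e)
  moreover have "e \<in> {x \<in> F. v \<in> x}" using F(3) \<open>v \<in> e\<close> by simp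
  ultimately have "{x \<in> F. v \<in> x} = {e}" by blast
  then have "deg F v = 1" by (simp add: deg_def)
  then show False using F(2) by blast
qed

lemma deg_sum:
  assumes "finite E" "finite X"
  shows "(\<Sum>v\<in>X. deg E v) = (\<Sum>e\<in>E. card (e \<inter> X))"
proof -
  have "(\<Sum>v\<in>X. deg E v) = (\<Sum>v\<in>X. \<Sum>e\<in>E. of_bool (v \<in> e))"
    using assms by (simp add: deg_def Int_def)
  also have "\<dots> = (\<Sum>e\<in>E. \<Sum>v\<in>X. of_bool (v \<in> e))" by (rule sum.swap)
  also have "\<dots> = (\<Sum>e\<in>E. card (e \<inter> X))"
    using assms by (intro sum.cong) (auto simp: Int_def conj_commute)
  finally show ?thesis .
qed

lemma deg_pos_iff: "finite E \<Longrightarrow> 0 < deg E v \<longleftrightarrow> v \<in> \<Union>E"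
  by (auto simp: deg_def card_gt_0_iff)

lemma finite_branch: "simple_edges E \<Longrightarrow> branch E \<subseteq> \<Union>E \<and> finite (branch E)"
proof -
  assume E: "simple_edges E"
  have "branch E \<subseteq> \<Union>E"
  proof
    fix v assume "v \<in> branch E"
    then have "0 < deg E v" by (simp add: branch_def)
    then show "v \<in> \<Union>E" by (simp only: deg_pos_iff[OF simple_edges_finite[OF E]])
  qed
  then show ?thesis using finite_subset[OF _ simple_edges_finite_Union[OF E]] by blast
qed

lemma deg_sum_lower:
  assumes "simple_edges E" "\<And>v. deg E v \<noteq> 1" "X \<subseteq> \<Union>E"
  shows "2 * card X + card (X \<inter> branch E) \<le> (\<Sum>v\<in>X. deg E v)"
proof -
  have fX: "finite X" using assms simple_edges_finite_Union finite_subset by metis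
  have "(\<Sum>v\<in>X. 2 + of_bool (v \<in> branch E)) \<le> (\<Sum>v\<in>X. deg E v)"
  proof (rule sum_mono)
    fix v assume "v \<in> X"
    then have "0 < deg E v" unfolding deg_pos_iff[OF simple_edges_finite[OF assms(1)]] using assms(3) by blast
    then show "2 + of_bool (v \<in> branch E) \<le> deg E v"
      using assms(2)[of v] by (auto simp: branch_def)
  qed
  moreover have "(\<Sum>v\<in>X. (2::nat) + of_bool (v \<in> branch E)) = 2 * card X + card (X \<inter> branch E)"
    unfolding sum.distrib using fX by (simp add: sum_of_bool_eq)
  ultimately show ?thesis by simp
qed

lemma last_path_edge:
  assumes "distinct p" "{x, last p} \<in> path_edges p"
  shows "2 \<le> length p \<and> x = p ! (length p - 2)"
proof -
  obtain i where i: "Suc i < length p" "{x, last p} = {p ! i, p ! Suc i}"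
    using assms(2) by (auto simp: path_edges_def)
  have "p \<noteq> []" using i by auto
  then have l: "last p = p ! (length p - 1)" by (simp add: last_conv_nth)
  have "last p \<noteq> p ! i" unfolding l using i assms(1) by (auto simp: nth_eq_iff_index_eq)
  then have x: "x = p ! i" "last p = p ! Suc i" using i(2) by (auto simp: doubleton_eq_iff)
  then have "length p - 1 = Suc i" using l i assms(1) by (auto simp: nth_eq_iff_index_eq)
  then have "length p - 2 = i" by simp
  then show ?thesis using x i by auto
qed

lemma conn_path_edges: "p \<noteq> [] \<Longrightarrow> conn (path_edges p) (hd p) (last p)"
  using path_imp_rtranclp[of p "\<lambda>u v. {u, v} \<in> path_edges p"] path_edges_subset_iff[of p "path_edges p"]
  by simp

lemma Union_cycle_edges:
  assumes "c \<noteq> []" shows "\<Union>(cycle_edges c) = set c"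
proof
  show "\<Union>(cycle_edges c) \<subseteq> set c"
    using assms unfolding cycle_edges_def by (auto intro!: nth_mem mod_less_divisor)
  show "set c \<subseteq> \<Union>(cycle_edges c)"
  proof
    fix v assume "v \<in> set c"
    then obtain i where "i < length c" "v = c ! i" by (metis in_set_conv_nth)
    then show "v \<in> \<Union>(cycle_edges c)" using nth_edge_in[of i c] by (auto simp: nth_edge_def)
  qed
qed

text \<open>In a graph without pendant vertices, the number of branch vertices reachable from a
  branch vertex by paths with j + 1 branch vertices doubles with j as long as no
  cycle with few branch vertices closes.\<close>

lemma cycle_with_few_branch_vertices:
  assumes E: "simple_edges E" "\<And>v. deg E v \<noteq> 1" and C0: "C0 \<subseteq> E" "circuit C0"
    and num: "2 * card E + 2 < 2 * card (\<Union>E) + 3 * 2 ^ i"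
  shows "\<exists>c. 3 \<le> length c \<and> distinct c \<and> cycle_edges c \<subseteq> E \<and> card (set c \<inter> branch E) \<le> 2 * i + 1"
proof (rule ccontr)
  assume contr: "\<not> ?thesis"
  let ?br = "branch E"
  have fE: "finite E" and fV: "finite (\<Union>E)" and fbr: "finite ?br" and brV: "?br \<subseteq> \<Union>E"
    using simple_edges_finite[OF E(1)] simple_edges_finite_Union[OF E(1)] finite_branch[OF E(1)] by blast+
  have many: "2 * i + 1 < card (\<Union>C \<inter> ?br)" if C: "C \<subseteq> E" "circuit C" for C
  proof -
    obtain c where c: "3 \<le> length c" "distinct c" "cycle_edges c = C" using C by (auto simp: circuit_def)
    moreover have "c \<noteq> []" using c by auto
    ultimately show ?thesis using contr Union_cycle_edges[of c] C not_le by metis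
  qed
  have "card (\<Union>C0 \<inter> ?br) \<noteq> 0" using many[OF C0] by simp
  then obtain r where r: "r \<in> ?br" by (metis Int_iff card.empty ex_in_conv)
  define gp where "gp x m p \<longleftrightarrow> p \<noteq> [] \<and> hd p = r \<and> last p = x \<and> distinct p \<and> path_edges p \<subseteq> E
      \<and> card (set p \<inter> ?br) \<le> m" for x m p
  define X where "X j = {x. \<exists>p. gp x (Suc j) p}" for j
  \<comment> \<open>Otherwise the two chosen paths and the edge between their ends contain a circuit
    with at most 2 m - 1 branch vertices, as r lies on both paths; m \<le> i + 1 turns this into 2 i
    + 1. So edges between reached vertices are last edges of chosen paths, as in a tree rooted at
    r.\<close>
  have edge_par: "({x, y} = {f x ! (length (f x) - 2), x} \<and> x \<noteq> r) \<or> ({x, y} = {f y ! (length (f y) - 2), y} \<and> y \<noteq> r)"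
    if m: "m \<le> i + 1" and gpf: "gp x m (f x)" "gp y m (f y)" and xy: "{x, y} \<in> E" for x y m f
  proof -
    have lastpar: "{a, b} = {f b ! (length (f b) - 2), b} \<and> b \<noteq> r"
      if "gp b m (f b)" "{a, b} \<in> path_edges (f b)" for a b
    proof -
      have p: "f b \<noteq> []" "hd (f b) = r" "last (f b) = b" "distinct (f b)" using that by (auto simp: gp_def)
      have l: "2 \<le> length (f b)" "a = f b ! (length (f b) - 2)"
        using last_path_edge[of "f b" a] p that by auto
      moreover have "f b ! 0 \<noteq> f b ! (length (f b) - 1)" using l p(4)
        by (subst nth_eq_iff_index_eq) auto
      ultimately show ?thesis using p by (auto simp: hd_conv_nth last_conv_nth)
    qed
    show ?thesis
    proof (cases "{x, y} \<in> path_edges (f y) \<or> {x, y} \<in> path_edges (f x)")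
      case True
      then show ?thesis using lastpar[of x y] lastpar[of y x] gpf by (auto simp: insert_commute)
    next
      case False
      let ?P = "path_edges (f x) \<union> path_edges (f y)"
      let ?H = "insert {x, y} ?P"
      have HE: "?H \<subseteq> E" using gpf xy by (auto simp: gp_def)
      have "conn (path_edges (f x)) r x" "conn (path_edges (f y)) r y"
        using conn_path_edges[of "f x"] conn_path_edges[of "f y"] gpf by (auto simp: gp_def)
      then have "conn ?P x y"
        using conn_mono[of "path_edges (f x)" ?P] conn_mono[of "path_edges (f y)" ?P] conn_sym conn_trans
        by (metis Un_upper1 Un_upper2)
      moreover have "?H - {{x, y}} = ?P" using False by auto
      ultimately obtain C where C: "C \<subseteq> ?H" "circuit C"
        using conn_edge_imp_circuit[of ?H x y] HE simple_edges_subset[OF E(1)] by fastforce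
      have "x \<in> set (f x)" "y \<in> set (f y)" using gpf unfolding gp_def by (metis last_in_set)+
      then have "\<Union>C \<subseteq> set (f x) \<union> set (f y)"
        using C(1) path_edges_Union[of "f x"] path_edges_Union[of "f y"] by blast
      then have "card (\<Union>C \<inter> ?br) \<le> card ((set (f x) \<inter> ?br) \<union> (set (f y) \<inter> ?br))"
        using fbr by (intro card_mono) auto
      moreover have "r \<in> (set (f x) \<inter> ?br) \<inter> (set (f y) \<inter> ?br)"
        using r gpf unfolding gp_def by (metis IntI list.set_sel(1))
      then have "0 < card ((set (f x) \<inter> ?br) \<inter> (set (f y) \<inter> ?br))" by (auto simp: card_gt_0_iff)
      moreover have "card (set (f x) \<inter> ?br) + card (set (f y) \<inter> ?br) =
          card ((set (f x) \<inter> ?br) \<union> (set (f y) \<inter> ?br)) + card ((set (f x) \<inter> ?br) \<inter> (set (f y) \<inter> ?br))"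
        by (rule card_Un_Int) auto
      moreover have "card (set (f x) \<inter> ?br) \<le> m" "card (set (f y) \<inter> ?br) \<le> m" using gpf by (auto simp: gp_def)
      ultimately have "card (\<Union>C \<inter> ?br) \<le> 2 * i + 1" using m by linarith
      then show ?thesis using many[of C] C HE by fastforce
    qed
  qed
  have XV: "X j \<subseteq> \<Union>E" for j
  proof
    fix x assume "x \<in> X j"
    then obtain p where p: "gp x (Suc j) p" by (auto simp: X_def)
    show "x \<in> \<Union>E"
    proof (cases "length p = 1")
      case True
      then have "x = r" using p by (auto simp: gp_def length_Suc_conv)
      then show ?thesis using r brV by blast
    next
      case False
      then have l: "Suc (length p - 2) < length p" "Suc (length p - 2) = length p - 1"
        using p by (auto simp: gp_def neq_Nil_conv)
      then have "{p ! (length p - 2), p ! (length p - 1)} \<in> path_edges p" by (auto simp: path_edges_def)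
      then have "{p ! (length p - 2), p ! (length p - 1)} \<in> E" using p by (auto simp: gp_def)
      moreover have "x = p ! (length p - 1)" using p by (auto simp: gp_def last_conv_nth)
      ultimately show ?thesis by blast
    qed
  qed
  have X_mono: "X j \<subseteq> X (Suc j)" for j by (auto simp: X_def gp_def)
  have rX: "r \<in> X j" for j
  proof -
    have "gp r (Suc j) [r]" using r by (auto simp: gp_def)
    then show ?thesis by (auto simp: X_def)
  qed
  have prefix: "set p \<subseteq> X j" if p: "gp x (Suc j) p" for x j p
  proof
    fix y assume "y \<in> set p"
    then obtain q s where q: "p = q @ y # s" by (meson split_list)
    have "path_edges (q @ [y]) \<subseteq> E" using p q unfolding gp_def path_edges_subset_iff
      by (auto simp: successively_append_iff)
    moreover have "card (set (q @ [y]) \<inter> ?br) \<le> card (set p \<inter> ?br)"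
      using q by (intro card_mono) auto
    ultimately have "gp y (Suc j) (q @ [y])" using p q unfolding gp_def by (auto simp: hd_append)
    then show "y \<in> X j" by (auto simp: X_def)
  qed
  have grow: "2 * card (X j \<inter> ?br) + 2 \<le> card (X (Suc j) \<inter> ?br)" if j: "Suc j \<le> i" for j
  proof -
    \<comment> \<open>The outer neighbours of \<open>X j\<close>. Each is a branch vertex, since
      otherwise the extended path would have no more branch vertices than before and its end would
      already be in \<open>X j\<close>.\<close>
    define Z where "Z = {z. z \<notin> X j \<and> (\<exists>x\<in>X j. {x, z} \<in> E)}"
    have "\<exists>f. \<forall>x\<in>X j. gp x (Suc j) (f x)" unfolding X_def by (intro bchoice) auto
    then obtain f0 where f0: "\<And>x. x \<in> X j \<Longrightarrow> gp x (Suc j) (f0 x)" by blast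
    have "\<exists>g. \<forall>z\<in>Z. g z \<in> X j \<and> {g z, z} \<in> E" by (intro bchoice) (auto simp: Z_def)
    then obtain g where g: "\<And>z. z \<in> Z \<Longrightarrow> g z \<in> X j \<and> {g z, z} \<in> E" by blast
    define f where "f y = (if y \<in> X j then f0 y else f0 (g y) @ [y])" for y
    have ext: "gp z (Suc (Suc j)) (f z) \<and> z \<in> ?br" if z: "z \<in> Z" for z
    proof -
      have zn: "z \<notin> X j" using z by (auto simp: Z_def)
      have p: "gp (g z) (Suc j) (f0 (g z))" using f0 g z by blast
      have fz: "f z = f0 (g z) @ [z]" using zn by (simp add: f_def)
      have zs: "z \<notin> set (f0 (g z))" using prefix[OF p] zn by auto
      have pe: "path_edges (f0 (g z) @ [z]) \<subseteq> E"
        using p g[OF z] by (subst path_edges_append) (auto simp: gp_def)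
      have *: "gp z m (f z) \<longleftrightarrow> card (set (f z) \<inter> ?br) \<le> m" for m
        using p zs pe unfolding fz gp_def by (auto simp: hd_append)
      have "set (f z) \<inter> ?br \<subseteq> insert z (set (f0 (g z)) \<inter> ?br)" using fz by auto
      then have "card (set (f z) \<inter> ?br) \<le> card (insert z (set (f0 (g z)) \<inter> ?br))" by (intro card_mono) auto
      also have "\<dots> \<le> Suc (Suc j)" using p by (simp add: gp_def card_insert_if)
      finally have 1: "gp z (Suc (Suc j)) (f z)" using * by simp
      have "z \<in> ?br"
      proof (rule ccontr)
        assume "z \<notin> ?br"
        then have "set (f z) \<inter> ?br = set (f0 (g z)) \<inter> ?br" using fz by auto
        moreover have "card (set (f0 (g z)) \<inter> ?br) \<le> Suc j" using p unfolding gp_def by blast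
        ultimately have "gp z (Suc j) (f z)" by (simp only: *)
        then show False using zn by (auto simp: X_def)
      qed
      then show ?thesis using 1 by simp
    qed
    have gpf: "gp y (Suc (Suc j)) (f y)" if "y \<in> X j \<union> Z" for y
    proof (cases "y \<in> X j")
      case True
      have "f y = f0 y" using True by (simp add: f_def)
      then show ?thesis using f0[OF True] unfolding gp_def by simp
    next
      case False
      then show ?thesis using ext that by blast
    qed
    have fX: "finite (X j)" using XV fV finite_subset by metis
    have ZV: "Z \<subseteq> \<Union>E" using ext brV by auto
    then have fZ: "finite Z" using fV finite_subset by metis
    \<comment> \<open>The last edge of the chosen path to y. For y = r that path is
      \<open>[r]\<close>, and truncated subtraction makes the value \<open>{r}\<close>, which is not
      an edge.\<close>
    define par where "par y = {f y ! (length (f y) - 2), y}" for y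
    have par: "({x, y} = par x \<and> x \<noteq> r) \<or> ({x, y} = par y \<and> y \<noteq> r)"
      if "x \<in> X j \<union> Z" "y \<in> X j \<union> Z" "{x, y} \<in> E" for x y
      unfolding par_def using edge_par[of "Suc (Suc j)" x f y] j gpf that by simp
    have parX: "par x \<subseteq> X j" if "x \<in> X j" for x
    proof -
      have "f x ! (length (f x) - 2) \<in> set (f x)" using gpf[of x] that
        by (intro nth_mem) (auto simp: gp_def)
      moreover have "set (f x) \<subseteq> X j" using prefix[OF f0[OF that]] that by (simp add: f_def)
      ultimately show ?thesis using that by (auto simp: par_def)
    qed
    define IE where "IE = {e \<in> E. e \<subseteq> X j}"
    define D where "D = {e \<in> E. e \<inter> X j \<noteq> {} \<and> \<not> e \<subseteq> X j}"
    have "IE \<subseteq> par ` (X j - {r})"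
    proof
      fix e assume e: "e \<in> IE"
      then have "e \<in> E" by (simp add: IE_def)
      then obtain x y where xy: "e = {x, y}" using simple_edgesE[OF E(1)] by metis
      then have xj: "x \<in> X j" "y \<in> X j" using e by (auto simp: IE_def)
      then have "(e = par x \<and> x \<noteq> r) \<or> (e = par y \<and> y \<noteq> r)"
        using par[of x y] xy \<open>e \<in> E\<close> by simp
      then show "e \<in> par ` (X j - {r})" using xj by blast
    qed
    then have "card IE \<le> card (X j - {r})" by (rule surj_card_le[rotated]) (simp add: fX)
    then have cIE: "card IE + 1 \<le> card (X j)" using card.remove[OF fX rX] by simp
    have "D \<subseteq> par ` Z"
    proof
      fix e assume e: "e \<in> D"
      then have "e \<in> E" by (simp add: D_def)
      then obtain x y where xy: "e = {x, y}" using simple_edgesE[OF E(1)] by metis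
      moreover have "{y, x} = {x, y}" by auto
      ultimately have "\<exists>x z. e = {x, z} \<and> x \<in> X j \<and> z \<notin> X j"
        using e unfolding D_def by (cases "x \<in> X j") auto
      then obtain x z where xz: "e = {x, z}" "x \<in> X j" "z \<notin> X j" by blast
      then have z: "z \<in> Z" using e by (auto simp: Z_def D_def)
      have "({x, z} = par x \<and> x \<noteq> r) \<or> ({x, z} = par z \<and> z \<noteq> r)"
        using par[of x z] xz z e by (simp add: D_def)
      moreover have "{x, z} \<noteq> par x" using parX[OF xz(2)] xz(3) by blast
      ultimately have "e = par z" using xz(1) by blast
      then show "e \<in> par ` Z" using z by simp
    qed
    then have cD: "card D \<le> card Z" by (rule surj_card_le[OF fZ])
    have "(\<Sum>v\<in>X j. deg E v) = (\<Sum>e\<in>E. card (e \<inter> X j))" using deg_sum fE fX by blast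
    also have "\<dots> = (\<Sum>e\<in>E. 2 * of_bool (e \<in> IE) + of_bool (e \<in> D))"
    proof (rule sum.cong)
      fix e assume e: "e \<in> E"
      then obtain x y where xy: "e = {x, y}" "x \<noteq> y" using simple_edgesE[OF E(1), of e] by metis
      then show "card (e \<inter> X j) = 2 * of_bool (e \<in> IE) + of_bool (e \<in> D)"
        using e by (cases "x \<in> X j"; cases "y \<in> X j") (auto simp: IE_def D_def Int_insert_left)
    qed simp
    also have "\<dots> = 2 * card IE + card D"
    proof -
      have "E \<inter> {e. e \<in> IE} = IE" "E \<inter> {e. e \<in> D} = D" by (auto simp: IE_def D_def)
      then show ?thesis using fE by (simp add: sum.distrib flip: sum_distrib_left)
    qed
    \<comment> \<open>Edges inside \<open>X j\<close> are parent edges of vertices other than r, and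
      edges leaving it are parent edges of vertices of Z. So Z has at least two more elements than
      \<open>X j\<close> has branch vertices.\<close>
    finally have "2 * card (X j) + card (X j \<inter> ?br) \<le> 2 * card IE + card D"
      using deg_sum_lower[OF E, of "X j"] XV by simp
    then have "card (X j \<inter> ?br) + 2 \<le> card Z" using cIE cD by linarith
    moreover have "card (X j \<inter> ?br) + card Z = card ((X j \<inter> ?br) \<union> Z)"
      using fX fZ by (intro card_Un_disjoint[symmetric]) (auto simp: Z_def)
    moreover have "Z \<subseteq> X (Suc j) \<inter> ?br" using ext by (auto simp: X_def)
    then have "card ((X j \<inter> ?br) \<union> Z) \<le> card (X (Suc j) \<inter> ?br)"
      using X_mono[of j] fbr by (intro card_mono) auto
    ultimately show ?thesis by linarith
  qed
  \<comment> \<open>Passing from b to at least 2 b + 2 at least doubles b + 2, which is at least 3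
    at the start because of r.\<close>
  have "3 * 2 ^ j \<le> card (X j \<inter> ?br) + 2" if "j \<le> i" for j
    using that
  proof (induction j)
    case 0
    have "r \<in> X 0 \<inter> ?br" using rX r by simp
    then have "0 < card (X 0 \<inter> ?br)" using fbr by (auto simp: card_gt_0_iff)
    then show ?case by simp
  next
    case (Suc j)
    then show ?case using grow[of j] by simp
  qed
  then have "3 * 2 ^ i \<le> card (X i \<inter> ?br) + 2" by simp
  also have "card (X i \<inter> ?br) \<le> card ?br" using fbr by (intro card_mono) auto
  finally have "3 * 2 ^ i \<le> card ?br + 2" by simp
  \<comment> \<open>Without pendant vertices, the degree sum bounds the number of branch vertices by
    twice the excess of edges over vertices.\<close>
  moreover have "2 * card (\<Union>E) + card ?br \<le> 2 * card E"
  proof -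
    have "(\<Sum>e\<in>E. card (e \<inter> \<Union>E)) = (\<Sum>e\<in>E. 2)"
    proof (rule sum.cong)
      fix e assume "e \<in> E"
      then have "e \<inter> \<Union>E = e" by auto
      then show "card (e \<inter> \<Union>E) = 2" using \<open>e \<in> E\<close> E(1) by (simp add: simple_edges_def)
    qed simp
    then have "(\<Sum>v\<in>\<Union>E. deg E v) = 2 * card E" using deg_sum[OF fE fV] by simp
    moreover have "\<Union>E \<inter> ?br = ?br" using brV by auto
    ultimately show ?thesis using deg_sum_lower[OF E, of "\<Union>E"] by simp
  qed
  ultimately show False using num by linarith
qed

section \<open>Packing and hitting all circuits\<close>

definition packs :: "('a set set \<Rightarrow> bool) \<Rightarrow> 'a set set \<Rightarrow> nat \<Rightarrow> bool" where
  "packs Q E k \<longleftrightarrow> (\<exists>f. (\<forall>i<k. Q (f i) \<and> f i \<subseteq> E) \<and> (\<forall>i<k. \<forall>j<k. i \<noteq> j \<longrightarrow> f i \<inter> f j = {}))"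

definition hits :: "('a set set \<Rightarrow> bool) \<Rightarrow> 'a set set \<Rightarrow> 'a set set \<Rightarrow> bool" where
  "hits Q E F \<longleftrightarrow> F \<subseteq> E \<and> (\<forall>C. C \<subseteq> E - F \<longrightarrow> \<not> Q C)"

lemma packs_mono: "packs Q E k \<Longrightarrow> E \<subseteq> E' \<Longrightarrow> j \<le> k \<Longrightarrow> (\<And>C. C \<subseteq> E \<Longrightarrow> Q C \<Longrightarrow> Q' C) \<Longrightarrow> packs Q' E' j"
  unfolding packs_def
proof (elim exE)
  fix f assume a: "E \<subseteq> E'" "j \<le> k" "\<And>C. C \<subseteq> E \<Longrightarrow> Q C \<Longrightarrow> Q' C"
    and f: "(\<forall>i<k. Q (f i) \<and> f i \<subseteq> E) \<and> (\<forall>i<k. \<forall>j<k. i \<noteq> j \<longrightarrow> f i \<inter> f j = {})"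
  have "Q' (f i)" "f i \<subseteq> E'" if "i < j" for i
    using f a(1,2) a(3)[of "f i"] that by (meson less_le_trans subset_trans)+
  moreover have "f i \<inter> f i' = {}" if "i < j" "i' < j" "i \<noteq> i'" for i i'
    using f that a(2) by (meson less_le_trans)
  ultimately show "\<exists>f. (\<forall>i<j. Q' (f i) \<and> f i \<subseteq> E') \<and> (\<forall>i<j. \<forall>i'<j. i \<noteq> i' \<longrightarrow> f i \<inter> f i' = {})"
    by (intro exI[of _ f]) simp
qed

lemma packs_Suc:
  assumes "packs Q (E - X) k" "Q C" "C \<subseteq> X" "X \<subseteq> E"
  shows "packs Q E (Suc k)"
proof -
  obtain f where f0: "(\<forall>i<k. Q (f i) \<and> f i \<subseteq> E - X) \<and> (\<forall>i<k. \<forall>j<k. i \<noteq> j \<longrightarrow> f i \<inter> f j = {})"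
    using assms(1) unfolding packs_def by (rule exE)
  have f: "Q (f i) \<and> f i \<subseteq> E - X" if "i < k" for i using f0 that by simp
  have disj: "f i \<inter> f j = {}" if "i < k" "j < k" "i \<noteq> j" for i j using f0 that by simp
  have d: "f i \<inter> C = {}" if "i < k" for i using f[OF that] assms(3) by blast
  show ?thesis unfolding packs_def
  proof (intro exI[of _ "f(k := C)"] conjI allI impI)
    fix i assume "i < Suc k"
    then show "Q ((f(k := C)) i)" "(f(k := C)) i \<subseteq> E" using f[of i] assms by (auto simp: less_Suc_eq)
    fix j assume "j < Suc k" "i \<noteq> j"
    then show "(f(k := C)) i \<inter> (f(k := C)) j = {}"
      using \<open>i < Suc k\<close> disj[of i j] d[of i] d[of j] by (auto simp: less_Suc_eq)
  qed
qed

text \<open>With i = 2 K + 3, an excess of j (4 K + 8) + 1 edges over vertices is small enough for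
  \<open>cycle_with_few_branch_vertices\<close>. The estimate comes down to
  \<open>2 * K + 5 < 6 * 2 ^ K\<close>.\<close>

lemma size_bound:
  fixes j K :: nat
  assumes "j \<le> 2 ^ K"
  shows "2 * (j * (4 * K + 8) + 1) + 2 < 3 * 2 ^ (2 * K + 3)"
proof -
  have "2 * K + 5 < 6 * 2 ^ K" by (induction K) auto
  then have "2 ^ K * (4 * (2 * K + 5)) < 2 ^ K * (4 * (6 * 2 ^ K))"
    by (metis mult_less_cancel1 zero_less_numeral zero_less_power)
  then have 1: "8 * (K * 2 ^ K) + 20 * 2 ^ K < 24 * (2 ^ K * 2 ^ K)" by (simp add: algebra_simps)
  have "j * (4 * K + 8) \<le> 2 ^ K * (4 * K + 8)" using assms by (rule mult_right_mono) simp
  moreover have "2 ^ K * (4 * K + 8) = 4 * (K * 2 ^ K) + 8 * 2 ^ K" by (simp add: algebra_simps)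
  moreover have "(2::nat) ^ (2 * K + 3) = 8 * (2 ^ K * 2 ^ K)"
    by (simp add: power_add power_mult power2_eq_square mult.commute flip: power_mult_distrib)
  moreover have "(1::nat) \<le> 2 ^ K" by simp
  moreover have "2 * (a + 1) + 2 < 3 * b" if "a \<le> p" "p = 4 * x + 8 * y" "b = 8 * z" "1 \<le> y" "8 * x + 20 * y < 24 * z"
    for a b p x y z :: nat
  proof -
    have "2 * (a + 1) + 2 \<le> 2 * p + 4" using that(1) by simp
    also have "\<dots> \<le> 8 * x + 20 * y" using that(2,4) by simp
    also have "\<dots> < 24 * z" using that(5) .
    also have "\<dots> = 3 * b" using that(3) by simp
    finally show ?thesis .
  qed
  ultimately show ?thesis using 1 by blast
qed

text \<open>The edge version of the Erdos-Posa theorem for circuits of any length; the dense case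
  applies it to a union of spanning trees. The allowance 4 K + 8 per circuit is one edge for each
  segment of a cycle with at most 4 K + 7 branch vertices.\<close>

lemma circuit_packing_or_hitting:
  assumes "simple_edges E" "k \<le> 2 ^ K"
  shows "packs circuit E k \<or> (\<exists>F. hits circuit E F \<and> card F \<le> k * (4 * K + 8))"
  using assms
proof (induction k arbitrary: E)
  case 0
  then show ?case by (auto simp: packs_def)
next
  case (Suc j)
  let ?T = "4 * K + 8"
  define small where "small H \<longleftrightarrow> (\<exists>F. hits circuit H F \<and> card F \<le> Suc j * ?T)" for H :: "'a set set"
  show ?case
  proof (cases "small E")
    case False
    have fE: "finite E" using Suc.prems simple_edges_finite by blast
    define bad where "bad H \<longleftrightarrow> H \<subseteq> E \<and> \<not> small H" for H
    have "bad E" using False by (simp add: bad_def)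
    \<comment> \<open>A smallest subgraph without a small hitting set. Deleting a single edge makes
      it hittable, and this bounds the excess of edges over vertices in its core; E itself may be
      too dense.\<close>
    then obtain H where H: "bad H" "\<And>S. bad S \<Longrightarrow> card H \<le> card S"
      using exists_least_iff[of "\<lambda>n. \<exists>T. bad T \<and> card T = n"] by (metis leI)
    have HE: "H \<subseteq> E" "\<not> small H" using H(1) by (auto simp: bad_def)
    have sH: "simple_edges H" using Suc.prems HE simple_edges_subset by metis
    have fH: "finite H" using sH simple_edges_finite by blast
    have "\<exists>C\<subseteq>H. circuit C"
    proof (rule ccontr)
      assume "\<not> ?thesis"
      then have "hits circuit H {}" by (auto simp: hits_def)
      then have "small H" unfolding small_def by (intro exI[of _ "{}"]) simp
      then show False using HE by blast
    qed
    then obtain C0 where C0: "C0 \<subseteq> H" "circuit C0" by blast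
    then obtain e where e: "e \<in> H" using circuit_nonempty by blast
    have "card (H - {e}) < card H" using e fH by (intro card_Diff1_less)
    then have "small (H - {e})" using H(2)[of "H - {e}"] HE by (auto simp: bad_def)
    then obtain F0 where F0: "hits circuit (H - {e}) F0" "card F0 \<le> Suc j * ?T" by (auto simp: small_def)
    define F1 where "F1 = insert e F0"
    have "finite F0" using F0 fH unfolding hits_def by (meson finite_Diff finite_subset)
    then have F1: "card F1 \<le> Suc j * ?T + 1" using F0 by (simp add: F1_def card_insert_if)
    have F1hit: "\<not> circuit C" if "C \<subseteq> H - F1" for C
      using that F0(1) unfolding hits_def F1_def by (metis Diff_insert insert_is_Un Diff_insert2)
    define G where "G = core H"
    have GH: "G \<subseteq> H" unfolding G_def by (rule core_subset)
    have sG: "simple_edges G" by (rule simple_edges_subset[OF sH GH])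
    have degG: "deg G v \<noteq> 1" for v unfolding G_def using fH by (rule deg_core)
    have circG: "C \<subseteq> G" if "C \<subseteq> H" "circuit C" for C
      unfolding G_def using that by (intro even_subset_core) (auto simp: circuit_odds)
    have "card (G - F1) \<le> card (\<Union>(G - F1))"
    proof (rule acyclic_card_le)
      show "simple_edges (G - F1)" by (rule simple_edges_subset[OF sG]) blast
      show "\<not> circuit C" if "C \<subseteq> G - F1" for C using F1hit[of C] that GH by blast
    qed
    also have "\<dots> \<le> card (\<Union>G)" using simple_edges_finite_Union[OF sG] by (intro card_mono) auto
    finally have "card G \<le> card (\<Union>G) + (Suc j * ?T + 1)"
      using diff_card_le_card_Diff[of F1 G] F1 \<open>finite F0\<close> by (simp add: F1_def)
    then have "2 * card G + 2 < 2 * card (\<Union>G) + 3 * 2 ^ (2 * K + 3)"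
    proof -
      have "2 * g + 2 < 2 * v + q" if "g \<le> v + (a + 1)" "2 * (a + 1) + 2 < q" for g v a q :: nat
        using that by arith
      then show ?thesis using size_bound[OF Suc.prems(2)] \<open>card G \<le> card (\<Union>G) + (Suc j * ?T + 1)\<close> by blast
    qed
    then obtain c where c: "3 \<le> length c" "distinct c" "cycle_edges c \<subseteq> G"
      "card (set c \<inter> branch G) \<le> 2 * (2 * K + 3) + 1"
      using cycle_with_few_branch_vertices[OF sG degG circG[OF C0] C0(2)] by blast
    \<comment> \<open>Starting indices of the segments between branch vertices. Index 0 is added
      because the segment that runs through the start of the list is cut there.\<close>
    define I where "I = insert 0 {i. i < length c \<and> c ! i \<in> branch G}"
    have fI: "finite I" by (simp add: I_def)
    have "card {i. i < length c \<and> c ! i \<in> branch G} \<le> card (set c \<inter> branch G)"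
      using c by (intro card_inj_on_le[where f="nth c"]) (auto simp: inj_on_def nth_eq_iff_index_eq)
    then have "card I \<le> ?T" using c(4) by (simp add: I_def card_insert_if)
    define A where "A = nth_edge c ` I"
    have A: "card A \<le> ?T" unfolding A_def using card_image_le[OF fI, of "nth_edge c"] \<open>card I \<le> ?T\<close> by linarith
    have "0 < length c" using c by auto
    then have AC: "A \<subseteq> cycle_edges c" unfolding A_def I_def by (auto intro: nth_edge_in)
    \<comment> \<open>Membership propagates along a segment, so a circuit that avoids the first edge
      of every segment avoids the whole cycle. Hence \<open>A\<close> makes up for the deletion of
      the cycle.\<close>
    have miss: "D \<inter> cycle_edges c = {}" if D: "D \<subseteq> H" "circuit D" "D \<inter> A = {}" for D
    proof -
      have "nth_edge c i \<notin> D" if "i < length c" for i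
        using that
      proof (induction i)
        case 0
        then show ?case using D(3) by (auto simp: A_def I_def)
      next
        case (Suc i)
        show ?case
        proof (cases "c ! Suc i \<in> branch G")
          case True
          then show ?thesis using D(3) Suc by (auto simp: A_def I_def)
        next
          case False
          have "c ! Suc i \<in> \<Union>G" using c(3) Union_cycle_edges[of c] \<open>0 < length c\<close> nth_mem[OF Suc.prems] by fastforce
          then have "deg G (c ! Suc i) = 2"
            using False degG[of "c ! Suc i"] deg_pos_iff[OF simple_edges_finite[OF sG], of "c ! Suc i"]
            by (auto simp: branch_def)
          then have "nth_edge c i \<in> D \<longleftrightarrow> nth_edge c (Suc i) \<in> D"
            using c Suc.prems D circG[OF D(1,2)] simple_edges_finite[OF sG]
              even_deg_neq_1[OF circuit_odds[OF D(2)], of "c ! Suc i"]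
            by (intro cycle_propagate[of c i G]) auto
          then show ?thesis using Suc by auto
        qed
      qed
      then show ?thesis by (auto simp: cycle_edges_nth_edge)
    qed
    have CH: "cycle_edges c \<subseteq> H" using c GH by auto
    have cc: "circuit (cycle_edges c)" using c by (auto simp: circuit_def)
    have "simple_edges (H - cycle_edges c)" by (rule simple_edges_subset[OF sH]) blast
    then consider "packs circuit (H - cycle_edges c) j"
      | F2 where "hits circuit (H - cycle_edges c) F2" "card F2 \<le> j * ?T"
      using Suc.IH[of "H - cycle_edges c"] Suc.prems by auto
    then show ?thesis
    proof cases
      case 1
      then have "packs circuit H (Suc j)" using packs_Suc cc CH by blast
      then show ?thesis using packs_mono[OF _ HE(1), of circuit "Suc j" "Suc j" circuit] by blast
    next
      case 2
      have "hits circuit H (F2 \<union> A)" unfolding hits_def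
      proof (intro conjI allI impI notI)
        show "F2 \<union> A \<subseteq> H" using 2 AC CH by (auto simp: hits_def)
        fix D assume D: "D \<subseteq> H - (F2 \<union> A)" "circuit D"
        then have "D \<inter> cycle_edges c = {}" using miss[of D] by blast
        then have "D \<subseteq> H - cycle_edges c - F2" using D by blast
        then show False using 2 D by (auto simp: hits_def)
      qed
      moreover have "card (F2 \<union> A) \<le> Suc j * ?T" using card_Un_le[of F2 A] 2 A by simp
      ultimately show ?thesis using HE by (auto simp: small_def)
    qed
  qed (auto simp: small_def)
qed

section \<open>Partitions of the edge set\<close>

lemma deg_cycle_vertex:
  assumes c: "3 \<le> length c" "distinct c" and v: "v \<in> set c"
  shows "deg (cycle_edges c) v = 2"
proof -
  have ne: "c \<noteq> []" using c by auto
  have pos: "deg (cycle_edges c) x = 2" if "x \<in> set c - {c ! 0}" for x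
  proof -
    have "x \<in> set c" using that by simp
    then obtain j where j: "j < length c" "c ! j = x" by (auto simp: in_set_conv_nth)
    have "j \<noteq> 0" using that j(2) by (intro notI) simp
    then obtain i where "j = Suc i" using not0_implies_Suc by blast
    then show ?thesis using deg_cycle_nth[OF c, of i] j by simp
  qed
  \<comment> \<open>\<open>deg_cycle_nth\<close> leaves out index 0, whose degree is what remains of
    the degree sum.\<close>
  have "deg (cycle_edges c) (c ! 0) = 2"
  proof -
    have "(\<Sum>x\<in>set c. deg (cycle_edges c) x) = (\<Sum>e\<in>cycle_edges c. card (e \<inter> set c))"
      by (rule deg_sum) simp_all
    also have "\<dots> = (\<Sum>e\<in>cycle_edges c. 2)"
    proof (rule sum.cong)
      fix e assume e: "e \<in> cycle_edges c"
      then have "e \<inter> set c = e" using Union_cycle_edges[OF ne] by blast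
      then show "card (e \<inter> set c) = 2" using simple_cycle_edges[OF c] e by (simp add: simple_edges_def)
    qed simp
    also have "\<dots> = 2 * length c" using card_cycle_edges[OF c] by simp
    finally have "(\<Sum>x\<in>set c. deg (cycle_edges c) x) = 2 * length c" .
    moreover have "(\<Sum>x\<in>set c. deg (cycle_edges c) x) =
        deg (cycle_edges c) (c ! 0) + (\<Sum>x\<in>set c - {c ! 0}. deg (cycle_edges c) x)"
      using ne by (intro sum.remove) auto
    moreover have "(\<Sum>x\<in>set c - {c ! 0}. deg (cycle_edges c) x) = (\<Sum>x\<in>set c - {c ! 0}. 2)"
      using pos by (intro sum.cong) auto
    moreover have "card (set c - {c ! 0}) = length c - 1"
      using distinct_card[OF c(2)] ne by (subst card_Diff_singleton) auto
    ultimately show ?thesis using c(1) by simp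
  qed
  then show ?thesis using pos[of v] v by (cases "v = c ! 0") auto
qed

locale edge_partition =
  fixes E :: "'a set set" and P :: "'a set set set"
  assumes simple: "simple_edges E" and part: "partition_on E P"
begin

definition good :: "'a set set \<Rightarrow> bool" where
  "good C \<longleftrightarrow> circuit C \<and> \<not> (\<exists>B\<in>P. C \<subseteq> B)"

definition inc :: "('a + 'a set set) set set" where
  "inc = {{Inl v, Inr B} | v B. B \<in> P \<and> v \<in> \<Union>B}"

text \<open>A class that meets H in an even set contributes nothing, which makes circuits inside a
  class invisible.\<close>

definition trace :: "'a set set \<Rightarrow> ('a + 'a set set) set set" where
  "trace H = {{Inl v, Inr B} | v B. B \<in> P \<and> v \<in> odds (H \<inter> B)}"

lemma class_subset: "B \<in> P \<Longrightarrow> B \<subseteq> E"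
  using partition_onD1[OF part] by blast

lemma class_simple: "B \<in> P \<Longrightarrow> simple_edges B"
  using simple_edges_subset[OF simple] class_subset by blast

lemma finite_E: "finite E"
  using simple by (rule simple_edges_finite)

lemma finite_P: "finite P"
  using finite_elements[OF finite_E part] .

lemma class_eq: "B \<in> P \<Longrightarrow> B' \<in> P \<Longrightarrow> e \<in> B \<Longrightarrow> e \<in> B' \<Longrightarrow> B = B'"
proof (rule ccontr)
  assume B: "B \<in> P" "B' \<in> P" "e \<in> B" "e \<in> B'" and "B \<noteq> B'"
  then have "B \<inter> B' = {}" using disjointD[OF partition_onD2[OF part]] by simp
  then show False using B by (simp add: disjoint_iff)
qed

lemma in_class: "e \<in> E \<Longrightarrow> \<exists>B\<in>P. e \<in> B"
  using partition_onD1[OF part] by blast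

lemma inc_edge_eq: "{Inl v, Inr B} = {Inl v', Inr B'} \<longleftrightarrow> v = v' \<and> B = B'"
  by (auto simp: doubleton_eq_iff)

lemma inc_mem_iff: "{Inl v, Inr B} \<in> inc \<longleftrightarrow> B \<in> P \<and> v \<in> \<Union>B"
  unfolding inc_def by (simp only: mem_Collect_eq inc_edge_eq) blast

lemma trace_mem_iff: "{Inl v, Inr B} \<in> trace H \<longleftrightarrow> B \<in> P \<and> v \<in> odds (H \<inter> B)"
  unfolding trace_def by (simp only: mem_Collect_eq inc_edge_eq) blast

lemma trace_subset_inc: "trace H \<subseteq> inc"
proof
  fix e assume "e \<in> trace H"
  then obtain v B where e: "e = {Inl v, Inr B}" "B \<in> P" "v \<in> odds (H \<inter> B)" by (auto simp: trace_def)
  then have "v \<in> \<Union>B" using subsetD[OF odds_subset_Union e(3)] by blast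
  then show "e \<in> inc" using e by (auto simp: inc_def)
qed

lemma simple_inc: "simple_edges inc"
proof -
  have "inc = (\<Union>B\<in>P. (\<lambda>v. {Inl v, Inr B}) ` \<Union>B)" by (auto simp: inc_def)
  moreover have "finite (\<Union>B)" if "B \<in> P" for B using class_simple[OF that] by (rule simple_edges_finite_Union)
  ultimately have "finite inc" using finite_P by simp
  moreover have "\<forall>e\<in>inc. card e = 2" by (auto simp: inc_def)
  ultimately show ?thesis by (simp add: simple_edges_def)
qed

lemma subset_incE:
  assumes "Z \<subseteq> inc" "e \<in> Z"
  obtains v B where "e = {Inl v, Inr B}" "B \<in> P" "v \<in> \<Union>B"
proof -
  have "e \<in> inc" using assms by blast
  then show ?thesis using that unfolding inc_def by blast
qed

lemma deg_inc_class:
  assumes "Z \<subseteq> inc"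
  shows "deg Z (Inr B) = card {v. {Inl v, Inr B} \<in> Z}"
proof -
  have "{e \<in> Z. Inr B \<in> e} = (\<lambda>v. {Inl v, Inr B}) ` {v. {Inl v, Inr B} \<in> Z}"
  proof (intro subset_antisym subsetI)
    fix e assume e: "e \<in> {e \<in> Z. Inr B \<in> e}"
    then obtain v B' where "e = {Inl v, Inr B'}" by (auto elim: subset_incE[OF assms])
    then show "e \<in> (\<lambda>v. {Inl v, Inr B}) ` {v. {Inl v, Inr B} \<in> Z}" using e by auto
  qed auto
  moreover have "inj_on (\<lambda>v. {Inl v, Inr B}) {v. {Inl v, Inr B} \<in> Z}"
    by (rule inj_onI) (simp only: inc_edge_eq)
  ultimately show ?thesis by (simp add: deg_def card_image)
qed

lemma deg_inc_vertex:
  assumes "Z \<subseteq> inc"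
  shows "deg Z (Inl v) = card {B. {Inl v, Inr B} \<in> Z}"
proof -
  have "{e \<in> Z. Inl v \<in> e} = (\<lambda>B. {Inl v, Inr B}) ` {B. {Inl v, Inr B} \<in> Z}"
  proof (intro subset_antisym subsetI)
    fix e assume e: "e \<in> {e \<in> Z. Inl v \<in> e}"
    then obtain v' B where "e = {Inl v', Inr B}" by (auto elim: subset_incE[OF assms])
    then show "e \<in> (\<lambda>B. {Inl v, Inr B}) ` {B. {Inl v, Inr B} \<in> Z}" using e by auto
  qed auto
  moreover have "inj_on (\<lambda>B. {Inl v, Inr B}) {B. {Inl v, Inr B} \<in> Z}"
    by (rule inj_onI) (simp only: inc_edge_eq)
  ultimately show ?thesis by (simp add: deg_def card_image)
qed

lemma deg_class_sum:
  assumes "H \<subseteq> E"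
  shows "deg H v = (\<Sum>B\<in>P. deg (H \<inter> B) v)"
proof -
  have "{e \<in> H. v \<in> e} = (\<Union>B\<in>P. {e \<in> H \<inter> B. v \<in> e})"
    using assms in_class by auto
  moreover have "card (\<Union>B\<in>P. {e \<in> H \<inter> B. v \<in> e}) = (\<Sum>B\<in>P. card {e \<in> H \<inter> B. v \<in> e})"
  proof (rule card_UN_disjoint)
    show "\<forall>B\<in>P. finite {e \<in> H \<inter> B. v \<in> e}"
      using finite_subset[OF assms finite_E] by simp
    show "\<forall>B\<in>P. \<forall>B'\<in>P. B \<noteq> B' \<longrightarrow> {e \<in> H \<inter> B. v \<in> e} \<inter> {e \<in> H \<inter> B'. v \<in> e} = {}"
      using class_eq by blast
  qed (rule finite_P)
  ultimately show ?thesis by (simp add: deg_def)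
qed

lemma even_deg_trace:
  assumes "H \<subseteq> E"
  shows "even (deg (trace H) (Inl v)) \<longleftrightarrow> even (deg H v)"
proof -
  have "{B. {Inl v, Inr B} \<in> trace H} = {B \<in> P. odd (deg (H \<inter> B) v)}"
    by (simp only: trace_mem_iff) (simp add: odds_def)
  then show ?thesis
    unfolding deg_inc_vertex[OF trace_subset_inc] deg_class_sum[OF assms]
    by (simp add: even_sum_iff[OF finite_P])
qed

text \<open>At a vertex node the trace has the parity of the degree in H; at a class node it counts
  the odd vertices of \<open>H \<inter> B\<close>, an even number by the handshake lemma.\<close>

lemma trace_even:
  assumes "H \<subseteq> E" "odds H = {}"
  shows "odds (trace H) = {}"
proof -
  have "even (deg (trace H) x)" for x
  proof (cases x)
    case (Inl v)
    then show ?thesis using even_deg_trace[OF assms(1), of v] assms(2) by (auto simp: odds_def)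
  next
    case (Inr B)
    have "simple_edges (H \<inter> B)" by (rule simple_edges_subset[OF simple]) (use assms in auto)
    then have "even (card (odds (H \<inter> B)))" by (rule even_card_odds)
    then show ?thesis using Inr
      by (cases "B \<in> P") (simp_all add: deg_inc_class[OF trace_subset_inc] trace_mem_iff)
  qed
  then show ?thesis by (simp add: odds_def)
qed

text \<open>Removing a circuit that lies in a class changes neither the evenness of H nor its trace,
  so a good circuit turns up before the edges run out.\<close>

lemma trace_nonempty_imp_good:
  assumes "H \<subseteq> E" "odds H = {}" "trace H \<noteq> {}"
  shows "\<exists>C\<subseteq>H. good C"
  using assms
proof (induction "card H" arbitrary: H rule: less_induct)
  case less
  have fH: "finite H" using less.prems(1) finite_E by (rule finite_subset)
  have "H \<noteq> {}"
  proof
    assume "H = {}"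
    then have "trace H = {}" by (simp add: trace_def)
    then show False using less.prems by simp
  qed
  then obtain C where C: "C \<subseteq> H" "circuit C"
    using even_imp_circuit[OF simple_edges_subset[OF simple less.prems(1)] less.prems(2)] by blast
  show ?case
  proof (cases "good C")
    case False
    then obtain B0 where B0: "B0 \<in> P" "C \<subseteq> B0" using C by (auto simp: good_def)
    have "card (H - C) < card H"
      using C circuit_nonempty fH by (intro psubset_card_mono) auto
    moreover have "odds (H - C) = {}" using odds_Diff[OF fH C(1)] less.prems C by (simp add: circuit_odds)
    moreover have "odds ((H - C) \<inter> B) = odds (H \<inter> B)" if "B \<in> P" for B
    proof (cases "B = B0")
      case True
      have "(H - C) \<inter> B = (H \<inter> B) - C" by blast
      then show ?thesis using odds_Diff[of "H \<inter> B" C] fH C B0 True by (simp add: circuit_odds)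
    next
      case False
      then have "(H - C) \<inter> B = H \<inter> B" using B0 class_eq that by blast
      then show ?thesis by simp
    qed
    then have "trace (H - C) = trace H" unfolding trace_def by blast
    moreover have "H - C \<subseteq> E" using less.prems(1) by blast
    ultimately obtain D where "D \<subseteq> H - C" "good D" using less.hyps[of "H - C"] less.prems by auto
    then show ?thesis by blast
  qed (use C in blast)
qed

text \<open>If \<open>C \<inter> B\<close> were even, it would be all of C by minimality.\<close>

lemma good_meets_class:
  assumes "good C" "B \<in> P" "C \<inter> B \<noteq> {}"
  shows "odds (C \<inter> B) \<noteq> {}"
proof
  assume "odds (C \<inter> B) = {}"
  then have "C \<inter> B = C" using circuit_minimal[of C "C \<inter> B"] assms by (simp add: good_def)
  then show False using assms unfolding good_def by blast
qed

lemma trace_good_nonempty: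
  assumes "good C" "C \<subseteq> E"
  shows "trace C \<noteq> {}"
proof -
  obtain e where "e \<in> C" using assms circuit_nonempty unfolding good_def by blast
  then obtain B where B: "B \<in> P" "C \<inter> B \<noteq> {}" using in_class assms(2) by blast
  then obtain v where "v \<in> odds (C \<inter> B)" using good_meets_class[OF assms(1)] by blast
  then have "{Inl v, Inr B} \<in> trace C" using B by (simp add: trace_mem_iff)
  then show ?thesis by blast
qed

lemma assemble_class:
  assumes "\<And>B. B \<in> P \<Longrightarrow> f B \<subseteq> B" "B \<in> P"
  shows "(\<Union>B\<in>P. f B) \<inter> B = f B"
  using assms class_eq by blast

text \<open>The way back from the incidence graph to E: sets chosen in the classes with the
  boundaries that Z prescribes have a union with trace Z, which is therefore even. So the part of a
  circuit in one class may be exchanged for any other part with the same odd vertices.\<close>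

lemma assemble_good:
  assumes "\<And>B. B \<in> P \<Longrightarrow> f B \<subseteq> B" and Z: "odds Z = {}" "Z \<noteq> {}" "Z \<subseteq> inc"
    and "\<And>B v. B \<in> P \<Longrightarrow> v \<in> odds (f B) \<longleftrightarrow> {Inl v, Inr B} \<in> Z"
  shows "\<exists>C\<subseteq>(\<Union>B\<in>P. f B). good C"
proof -
  let ?H = "\<Union>B\<in>P. f B"
  have HE: "?H \<subseteq> E" using assms(1) class_subset by blast
  have mem: "{Inl v, Inr B} \<in> trace ?H \<longleftrightarrow> {Inl v, Inr B} \<in> Z" for v B
    using assms(5)[of B v] assemble_class[of f B] assms(1) subsetD[OF Z(3), of "{Inl v, Inr B}"]
    by (auto simp: trace_mem_iff inc_mem_iff)
  have tr: "trace ?H = Z"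
  proof (intro subset_antisym subsetI)
    fix e assume e: "e \<in> trace ?H"
    then obtain v B where "e = {Inl v, Inr B}" by (rule subset_incE[OF trace_subset_inc])
    then show "e \<in> Z" using e mem by simp
  next
    fix e assume e: "e \<in> Z"
    then obtain v B where "e = {Inl v, Inr B}" by (rule subset_incE[OF Z(3)])
    then show "e \<in> trace ?H" using e mem by simp
  qed
  have "even (deg ?H v)" for v
    using even_deg_trace[OF HE, of v] Z(1) unfolding tr odds_def by blast
  then have "odds ?H = {}" by (simp add: odds_def)
  then show ?thesis using trace_nonempty_imp_good[OF HE] tr Z(2) by simp
qed

text \<open>Spanning trees of the classes in the core have at least as large a surplus of edges over
  vertices as the core. A circuit in their union is good, as inside one class it would lie in a
  tree, so the theorem for all circuits applies.\<close>

lemma good_packing_if_dense: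
  assumes conn: "\<And>B p q. B \<in> P \<Longrightarrow> p \<in> \<Union>B \<Longrightarrow> q \<in> \<Union>B \<Longrightarrow> conn B p q"
    and k: "k \<le> 2 ^ K" and big: "card (\<Union>(core inc)) + k * (4 * K + 8) < card (core inc)"
  shows "packs good E k"
proof -
  define I0 where "I0 = core inc"
  have I0: "I0 \<subseteq> inc" unfolding I0_def by (rule core_subset)
  have sI0: "simple_edges I0" by (rule simple_edges_subset[OF simple_inc I0])
  define P0 where "P0 = {B \<in> P. Inr B \<in> \<Union>I0}"
  define N where "N B = {v. {Inl v, Inr B} \<in> I0}" for B
  have fP0: "finite P0" using finite_P by (simp add: P0_def)
  have P0P: "B \<in> P" if "B \<in> P0" for B using that by (simp add: P0_def)
  have fU: "finite (\<Union>B)" if "B \<in> P" for B using class_simple[OF that] by (rule simple_edges_finite_Union)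
  have NB: "N B \<subseteq> \<Union>B" for B
  proof
    fix v assume "v \<in> N B"
    then have "{Inl v, Inr B} \<in> inc" using I0 by (auto simp: N_def)
    then show "v \<in> \<Union>B" by (simp only: inc_mem_iff)
  qed
  have "\<exists>T. \<forall>B\<in>P. T B \<subseteq> B \<and> (\<forall>C\<subseteq>T B. \<not> circuit C) \<and> card (\<Union>B) \<le> card (T B) + 1"
    using spanning_tree[OF class_simple conn] by (intro bchoice ballI) blast
  then obtain T where T: "\<And>B. B \<in> P \<Longrightarrow> T B \<subseteq> B" "\<And>B C. B \<in> P \<Longrightarrow> C \<subseteq> T B \<Longrightarrow> \<not> circuit C"
    "\<And>B. B \<in> P \<Longrightarrow> card (\<Union>B) \<le> card (T B) + 1" by blast
  define G where "G = (\<Union>B\<in>P0. T B)"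
  have GE: "G \<subseteq> E" unfolding G_def using T(1) P0P class_subset by blast
  have sG: "simple_edges G" by (rule simple_edges_subset[OF simple GE])
  have "card G = (\<Sum>B\<in>P0. card (T B))" unfolding G_def
  proof (rule card_UN_disjoint)
    show "\<forall>B\<in>P0. finite (T B)" using T(1) P0P class_subset finite_E by (meson finite_subset)
    show "\<forall>B\<in>P0. \<forall>B'\<in>P0. B \<noteq> B' \<longrightarrow> T B \<inter> T B' = {}" using T(1) P0P class_eq by blast
  qed (rule fP0)
  moreover have "(\<Sum>B\<in>P0. card (\<Union>B)) \<le> (\<Sum>B\<in>P0. card (T B) + 1)"
    using T(3) P0P by (intro sum_mono) blast
  moreover have "(\<Sum>B\<in>P0. card (T B) + 1) = (\<Sum>B\<in>P0. card (T B)) + card P0"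
    by (simp only: sum.distrib) simp
  ultimately have cG: "(\<Sum>B\<in>P0. card (\<Union>B)) \<le> card G + card P0" by linarith
  have "card (\<Union>B) = card (N B) + card (\<Union>B - N B)" if "B \<in> P0" for B
  proof -
    have "card (\<Union>B - N B) = card (\<Union>B) - card (N B)" "card (N B) \<le> card (\<Union>B)"
      using fU[OF P0P[OF that]] NB by (auto intro: card_Diff_subset finite_subset card_mono)
    then show ?thesis by simp
  qed
  then have cU: "(\<Sum>B\<in>P0. card (\<Union>B)) = (\<Sum>B\<in>P0. card (N B)) + (\<Sum>B\<in>P0. card (\<Union>B - N B))"
    by (simp add: sum.distrib[symmetric])
  have "I0 \<subseteq> (\<Union>B\<in>P0. (\<lambda>v. {Inl v, Inr B}) ` N B)"
  proof
    fix e assume e: "e \<in> I0"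
    then obtain v B where vB: "e = {Inl v, Inr B}" "B \<in> P" by (rule subset_incE[OF I0])
    then have "v \<in> N B" "B \<in> P0" using e by (auto simp: N_def P0_def)
    then show "e \<in> (\<Union>B\<in>P0. (\<lambda>v. {Inl v, Inr B}) ` N B)" using vB(1) by blast
  qed
  moreover have fN: "finite (N B)" if "B \<in> P0" for B using fU[OF P0P[OF that]] NB by (rule finite_subset[rotated])
  ultimately have "card I0 \<le> card (\<Union>B\<in>P0. (\<lambda>v. {Inl v, Inr B}) ` N B)"
    using fP0 by (intro card_mono) auto
  also have "\<dots> \<le> (\<Sum>B\<in>P0. card ((\<lambda>v. {Inl v, Inr B}) ` N B))" using fP0 by (rule card_UN_le)
  also have "\<dots> \<le> (\<Sum>B\<in>P0. card (N B))" using fN by (intro sum_mono card_image_le)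
  finally have cI0: "card I0 \<le> (\<Sum>B\<in>P0. card (N B))" .
  have "Inr ` P0 \<union> Inl ` (\<Union>B\<in>P0. N B) \<subseteq> \<Union>I0"
    unfolding P0_def N_def by auto
  then have "card (Inr ` P0 \<union> Inl ` (\<Union>B\<in>P0. N B)) \<le> card (\<Union>I0)"
    using simple_edges_finite_Union[OF sI0] by (intro card_mono)
  moreover have "card (Inr ` P0 \<union> Inl ` (\<Union>B\<in>P0. N B)) = card P0 + card (\<Union>B\<in>P0. N B)"
    using fP0 fN by (subst card_Un_disjoint) (auto simp: card_image)
  ultimately have cV: "card P0 + card (\<Union>B\<in>P0. N B) \<le> card (\<Union>I0)" by simp
  define U where "U = (\<Union>B\<in>P0. \<Union>B)"
  have "U \<subseteq> (\<Union>B\<in>P0. N B) \<union> (\<Union>B\<in>P0. \<Union>B - N B)" by (auto simp: U_def)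
  then have "card U \<le> card ((\<Union>B\<in>P0. N B) \<union> (\<Union>B\<in>P0. \<Union>B - N B))"
    using fP0 fN fU P0P by (intro card_mono) auto
  also have "\<dots> \<le> card (\<Union>B\<in>P0. N B) + card (\<Union>B\<in>P0. \<Union>B - N B)" by (rule card_Un_le)
  also have "\<dots> \<le> card (\<Union>B\<in>P0. N B) + (\<Sum>B\<in>P0. card (\<Union>B - N B))" using card_UN_le[OF fP0] by simp
  finally have cUU: "card U \<le> card (\<Union>B\<in>P0. N B) + (\<Sum>B\<in>P0. card (\<Union>B - N B))" .
  \<comment> \<open>\<open>card G - card U\<close> is at least the sum of the
    \<open>card (N B)\<close>, minus \<open>card P0\<close>, minus the size of the union of the
    \<open>N B\<close>. The sum is at least the number of edges of the core, and the two subtracted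
    terms together are at most its number of vertices.\<close>
  have GU: "card U + k * (4 * K + 8) < card G" using cG cU cI0 cV cUU big unfolding I0_def by linarith
  have fU': "finite U" using fP0 fU P0P by (auto simp: U_def)
  have "\<not> hits circuit G F" if "card F \<le> k * (4 * K + 8)" for F
  proof
    assume h: "hits circuit G F"
    have "card (G - F) \<le> card (\<Union>(G - F))"
      using h simple_edges_subset[OF sG, of "G - F"] by (intro acyclic_card_le) (auto simp: hits_def)
    also have "\<Union>(G - F) \<subseteq> U" unfolding G_def U_def using T(1) P0P by blast
    then have "card (\<Union>(G - F)) \<le> card U" using fU' by (intro card_mono)
    finally have "card (G - F) \<le> card U" .
    moreover have "card G \<le> card (G - F) + card F"
      using h diff_card_le_card_Diff[of F G] finite_subset[of F G] simple_edges_finite[OF sG]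
      by (simp add: hits_def)
    ultimately show False using GU that by linarith
  qed
  then have "packs circuit G k" using circuit_packing_or_hitting[OF sG k] by blast
  moreover have "good C" if "C \<subseteq> G" "circuit C" for C
  proof -
    have False if B: "B \<in> P" "C \<subseteq> B" for B
    proof -
      have "C \<subseteq> T B"
      proof
        fix e assume e: "e \<in> C"
        then obtain B' where "B' \<in> P0" "e \<in> T B'" using \<open>C \<subseteq> G\<close> unfolding G_def by blast
        then show "e \<in> T B" using class_eq[of B B' e] B e T(1)[of B'] P0P[of B'] by blast
      qed
      then show False using T(2)[OF B(1)] \<open>circuit C\<close> by blast
    qed
    then show ?thesis using \<open>circuit C\<close> by (auto simp: good_def)
  qed
  ultimately show ?thesis using packs_mono[OF _ GE, of circuit k k good] by blast
qed

end

section \<open>Reduction along a cycle of the incidence graph\<close>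

lemma even_subset_doubleton:
  assumes "S \<noteq> {}" "even (card S)" "S \<subseteq> {a, b}"
  shows "S = {a, b}"
proof (rule ccontr)
  assume "S \<noteq> {a, b}"
  then have "S = {a} \<or> S = {b}" using assms(1,3) by blast
  then show False using assms(2) by auto
qed

context edge_partition
begin

text \<open>A cycle through few branch nodes of the incidence graph is realised in E: by a short
  chain in each branch class, and by a path that costs one unit of connectivity in any other
  class. A maximal run of classes between two branch nodes is traversed completely or not at all
  by a good circuit, so that cutting one class of the run suffices.\<close>

lemma good_reduction:
  assumes chain: "\<And>B p q. B \<in> P \<Longrightarrow> p \<in> \<Union>B \<Longrightarrow> q \<in> \<Union>B \<Longrightarrow> p \<noteq> q \<Longrightarrow> \<exists>R\<subseteq>B. card R \<le> m \<and> odds R = {p, q}"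
    and k: "k \<le> 2 ^ K" and sparse: "card (core inc) \<le> card (\<Union>(core inc)) + k * (4 * K + 8)"
    and D0: "good D0" "D0 \<subseteq> E"
  shows "\<exists>X\<subseteq>E. (\<exists>D\<subseteq>X. good D) \<and> (\<forall>F'. hits good (E - X) F' \<longrightarrow>
           (\<exists>F. hits good E F \<and> card F \<le> card F' + (4 * K + 8) * (m + 1)))"
proof -
  define I0 where "I0 = core inc"
  have I0: "I0 \<subseteq> inc" unfolding I0_def by (rule core_subset)
  have sI0: "simple_edges I0" by (rule simple_edges_subset[OF simple_inc I0])
  have fI0: "finite I0" using sI0 by (rule simple_edges_finite)
  have degI0: "deg I0 x \<noteq> 1" for x
    unfolding I0_def using simple_edges_finite[OF simple_inc] by (rule deg_core)
  have evenI0: "Z \<subseteq> I0" if "Z \<subseteq> inc" "odds Z = {}" for Z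
    unfolding I0_def using that by (rule even_subset_core)
  let ?br = "branch I0"
  have oD0: "odds D0 = {}" using D0(1) by (simp add: good_def circuit_odds)
  have "odds (trace D0) = {}" "trace D0 \<subseteq> inc" "trace D0 \<noteq> {}"
    using trace_even[OF D0(2) oD0] trace_subset_inc trace_good_nonempty[OF D0] by simp_all
  then obtain C0 where "C0 \<subseteq> trace D0" "circuit C0"
    using even_imp_circuit[OF simple_edges_subset[OF simple_inc]] by metis
  then have C0: "C0 \<subseteq> I0" "circuit C0"
    using evenI0[OF trace_subset_inc trace_even[OF D0(2) oD0]] by simp_all
  have "2 * card I0 + 2 < 2 * card (\<Union>I0) + 3 * 2 ^ (2 * K + 3)"
  proof -
    have "2 * x + 2 < 2 * y + q" if "x \<le> y + t" "2 * (t + 1) + 2 < q" for x y t q :: nat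
      using that by arith
    then show ?thesis using sparse size_bound[OF k] unfolding I0_def by blast
  qed
  then obtain w where w: "3 \<le> length w" "distinct w" "cycle_edges w \<subseteq> I0"
      "card (set w \<inter> ?br) \<le> 2 * (2 * K + 3) + 1"
    using cycle_with_few_branch_vertices[OF sI0 degI0 C0] by blast
  define W where "W = cycle_edges w"
  have WI: "W \<subseteq> inc" using w(3) I0 by (simp add: W_def)
  have circW: "circuit W" using w by (auto simp: circuit_def W_def)
  have wne: "w \<noteq> []" using w by auto
  have "deg I0 x \<noteq> 0" if "x \<in> set w" for x
  proof -
    have "x \<in> \<Union>I0" using that Union_cycle_edges[OF wne] w(3) by blast
    then show ?thesis using deg_pos_iff[OF fI0, of x] by simp
  qed
  then have deg2: "deg I0 x = 2" if "x \<in> set w" "x \<notin> ?br" for x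
    using degI0[of x] that by (fastforce simp: branch_def)
  define Q where "Q = {B. Inr B \<in> set w}"
  define NB where "NB = {B \<in> Q. Inr B \<notin> ?br}"
  have fQ: "finite Q" unfolding Q_def by (rule finite_vimageI[of "set w" Inr, unfolded vimage_def]) auto
  have NBQ: "NB \<subseteq> Q" by (auto simp: NB_def)
  define N where "N B = {v. {Inl v, Inr B} \<in> W}" for B
  have "\<exists>a b. a \<noteq> b \<and> N B = {a, b}" if "B \<in> Q" for B
  proof -
    have "deg W (Inr B) = 2" unfolding W_def using that by (intro deg_cycle_vertex w) (simp add: Q_def)
    then have "card (N B) = 2" by (simp only: deg_inc_class[OF WI] N_def)
    then show ?thesis unfolding card_2_iff by blast
  qed
  then obtain a b where ab': "\<And>B. B \<in> Q \<Longrightarrow> a B \<noteq> b B \<and> N B = {a B, b B}" by metis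
  have ab: "a B \<noteq> b B" if "B \<in> Q" for B using ab'[OF that] by blast
  have Wab: "{Inl v, Inr B} \<in> W \<longleftrightarrow> v = a B \<or> v = b B" if "B \<in> Q" for B v
  proof -
    have "{Inl v, Inr B} \<in> W \<longleftrightarrow> v \<in> N B" by (simp only: N_def mem_Collect_eq)
    then show ?thesis using ab'[OF that] by simp
  qed
  have QP: "B \<in> P" "a B \<in> \<Union>B" "b B \<in> \<Union>B" if "B \<in> Q" for B
  proof -
    have "{Inl (a B), Inr B} \<in> inc" "{Inl (b B), Inr B} \<in> inc" using Wab[OF that] WI by blast+
    then show "B \<in> P" "a B \<in> \<Union>B" "b B \<in> \<Union>B" by (simp_all only: inc_mem_iff)
  qed
  have WQ: "B \<in> Q" if "{Inl v, Inr B} \<in> W" for v B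
  proof -
    have "Inr B \<in> \<Union>W" using that by blast
    then show ?thesis unfolding W_def Union_cycle_edges[OF wne] Q_def by simp
  qed
  \<comment> \<open>A branch class is charged its whole piece, which has to be short. In other
    classes the last clause limits the damage: a cut of the rest of B is at most one edge cheaper
    than some cut of B.\<close>
  define realises where "realises B X \<longleftrightarrow> X \<subseteq> B \<and> conn X (a B) (b B) \<and> (Inr B \<in> ?br \<longrightarrow> card X \<le> m) \<and>
      (Inr B \<notin> ?br \<longrightarrow> (\<forall>S. \<not> conn (B - X - S) (a B) (b B) \<longrightarrow>
           (\<exists>S'\<subseteq>B. \<not> conn (B - S') (a B) (b B) \<and> card S' \<le> card (S \<inter> B) + 1)))" for B X
  have "\<exists>X. realises B X" if B: "B \<in> Q" for B
  proof -
    have sB: "simple_edges B" using class_simple QP[OF B] by blast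
    obtain R where R: "R \<subseteq> B" "card R \<le> m" "odds R = {a B, b B}" using chain[OF QP[OF B] ab[OF B]] by blast
    have cR: "conn R (a B) (b B)" using chain_imp_conn2[OF simple_edges_subset[OF sB R(1)] R(3) ab[OF B]] .
    show ?thesis
    proof (cases "Inr B \<in> ?br")
      case True
      then show ?thesis unfolding realises_def using R cR by (intro exI[of _ R]) simp
    next
      case False
      obtain X where "X \<subseteq> B" "conn X (a B) (b B)" "\<forall>S. \<not> conn (B - X - S) (a B) (b B) \<longrightarrow>
           (\<exists>S'\<subseteq>B. \<not> conn (B - S') (a B) (b B) \<and> card S' \<le> card (S \<inter> B) + 1)"
        using removable_path[OF sB ab[OF B] conn_mono[OF R(1) cR]] by blast
      then show ?thesis unfolding realises_def using False by (intro exI[of _ X]) (simp only: simp_thms)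
    qed
  qed
  then obtain piece where real: "\<And>B. B \<in> Q \<Longrightarrow> realises B (piece B)" by metis
  have piece: "\<And>B. B \<in> Q \<Longrightarrow> piece B \<subseteq> B" "\<And>B. B \<in> Q \<Longrightarrow> conn (piece B) (a B) (b B)"
    and short: "\<And>B. B \<in> Q \<Longrightarrow> Inr B \<in> ?br \<Longrightarrow> card (piece B) \<le> m"
    using real unfolding realises_def by blast+
  have cut: "\<And>B S. B \<in> Q \<Longrightarrow> Inr B \<notin> ?br \<Longrightarrow> \<not> conn (B - piece B - S) (a B) (b B) \<Longrightarrow>
           \<exists>S'\<subseteq>B. \<not> conn (B - S') (a B) (b B) \<and> card S' \<le> card (S \<inter> B) + 1"
    using real unfolding realises_def by blast
  define X where "X = (\<Union>B\<in>P. if B \<in> Q then piece B else {})"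
  have XE: "X \<subseteq> E" unfolding X_def using piece(1) class_subset by (auto split: if_splits)
  have Xcap: "X \<inter> B = (if B \<in> Q then piece B else {})" if "B \<in> P" for B
    unfolding X_def using that piece(1) by (intro assemble_class) auto
  have "\<exists>R. R \<subseteq> piece B \<and> odds R = {a B, b B}" if "B \<in> Q" for B
  proof -
    have "simple_edges (piece B)" using simple_edges_subset[OF class_simple[OF QP(1)[OF that]] piece(1)[OF that]] .
    then show ?thesis using conn_imp_chain2[OF _ piece(2)[OF that] ab[OF that]] by blast
  qed
  then obtain R where R: "\<And>B. B \<in> Q \<Longrightarrow> R B \<subseteq> piece B" "\<And>B. B \<in> Q \<Longrightarrow> odds (R B) = {a B, b B}" by metis
  \<comment> \<open>With W prescribed as trace, chains inside the pieces contain a good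
    circuit.\<close>
  have "\<exists>C\<subseteq>(\<Union>B\<in>P. if B \<in> Q then R B else {}). good C" (is "\<exists>C\<subseteq>?R. good C")
  proof (rule assemble_good)
    show "(if B \<in> Q then R B else {}) \<subseteq> B" if "B \<in> P" for B using R(1) piece(1) by auto
    show "odds W = {}" using circW by (rule circuit_odds)
    show "W \<noteq> {}" using circW by (rule circuit_nonempty)
    show "W \<subseteq> inc" by (rule WI)
    show "v \<in> odds (if B \<in> Q then R B else {}) \<longleftrightarrow> {Inl v, Inr B} \<in> W" if "B \<in> P" for B v
      using R(2)[of B] Wab[of B v] WQ[of v B] by auto
  qed
  then obtain D1 where D1: "D1 \<subseteq> ?R" "good D1" by (elim exE conjE)
  have "?R \<subseteq> X" unfolding X_def using R(1) by (intro UN_mono) auto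
  then have goodX: "\<exists>D\<subseteq>X. good D" using D1(2) subset_trans[OF D1(1)] by (intro exI[of _ D1] conjI)
  \<comment> \<open>Names the run of index i by the last branch node up to i, or by 0 before the
    first one; so there is at most one run more than there are branch nodes on w.\<close>
  define lab where "lab i = Max (insert 0 {j. j \<le> i \<and> w ! j \<in> ?br})" for i
  have finlab: "finite {j. j \<le> i \<and> w ! j \<in> ?br}" for i by simp
  have lab_le: "lab i \<le> i" for i unfolding lab_def by (subst Max_le_iff) auto
  have lab_ge: "j \<le> lab i" if "j \<le> i" "w ! j \<in> ?br" for i j unfolding lab_def using that by (intro Max_ge) auto
  have lab_in: "lab i \<in> insert 0 {j. j \<le> i \<and> w ! j \<in> ?br}" for i unfolding lab_def by (intro Max_in) auto
  have "\<exists>i<length w. w ! i = Inr B" if "B \<in> NB" for B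
    using that by (auto simp: NB_def Q_def in_set_conv_nth)
  then obtain ix where ix: "\<And>B. B \<in> NB \<Longrightarrow> ix B < length w" "\<And>B. B \<in> NB \<Longrightarrow> w ! ix B = Inr B" by metis
  have cardlab: "card ((\<lambda>B. lab (ix B)) ` NB) \<le> card (set w \<inter> ?br) + 1"
  proof -
    have "(\<lambda>B. lab (ix B)) ` NB \<subseteq> insert 0 {j. j < length w \<and> w ! j \<in> ?br}"
    proof (rule image_subsetI)
      fix B assume "B \<in> NB"
      then show "lab (ix B) \<in> insert 0 {j. j < length w \<and> w ! j \<in> ?br}"
        using lab_in[of "ix B"] ix(1)[of B] by auto
    qed
    then have "card ((\<lambda>B. lab (ix B)) ` NB) \<le> card (insert 0 {j. j < length w \<and> w ! j \<in> ?br})"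
      by (intro card_mono) auto
    also have "\<dots> \<le> card {j. j < length w \<and> w ! j \<in> ?br} + 1" by (simp add: card_insert_if)
    also have "card {j. j < length w \<and> w ! j \<in> ?br} \<le> card (set w \<inter> ?br)"
      using w(2) by (intro card_inj_on_le[where f="nth w"]) (auto simp: inj_on_def nth_eq_iff_index_eq)
    finally show ?thesis by simp
  qed
  have "\<exists>F. hits good E F \<and> card F \<le> card F' + (4 * K + 8) * (m + 1)" if F': "hits good (E - X) F'" for F'
  proof -
    have F'E: "F' \<subseteq> E - X" using F' by (simp add: hits_def)
    then have fF': "finite F'" using finite_E by (meson finite_Diff finite_subset)
    \<comment> \<open>Non-branch classes with this property are those that F' separates once the
      piece is gone. It will suffice to cut one of them in each run that has any.\<close>
    define sep where "sep B \<longleftrightarrow> \<not> conn (B - piece B - F') (a B) (b B)" for B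
    define g where "g B = lab (ix B)" for B
    define L where "L = g ` {B \<in> NB. sep B}"
    have fNB: "finite NB" using finite_subset[OF NBQ fQ] .
    have fL: "finite L" using fNB by (simp add: L_def)
    have "\<exists>B. B \<in> NB \<and> sep B \<and> g B = y" if "y \<in> L" for y using that by (auto simp: L_def)
    then obtain h where h: "\<And>y. y \<in> L \<Longrightarrow> h y \<in> NB" "\<And>y. y \<in> L \<Longrightarrow> sep (h y)" "\<And>y. y \<in> L \<Longrightarrow> g (h y) = y"
      by metis
    have "\<exists>S'. S' \<subseteq> h y \<and> \<not> conn (h y - S') (a (h y)) (b (h y)) \<and> card S' \<le> card (F' \<inter> h y) + 1" if "y \<in> L" for y
      using cut[of "h y" F'] h(1,2)[OF that] unfolding NB_def sep_def by blast
    then obtain S where S: "\<And>y. y \<in> L \<Longrightarrow> S y \<subseteq> h y" "\<And>y. y \<in> L \<Longrightarrow> \<not> conn (h y - S y) (a (h y)) (b (h y))"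
      "\<And>y. y \<in> L \<Longrightarrow> card (S y) \<le> card (F' \<inter> h y) + 1" by metis
    \<comment> \<open>Inside the non-branch classes F' is replaced by the cuts \<open>S y\<close>;
      outside them it is kept, and the pieces of the branch classes are added.\<close>
    define F where "F = (\<Union>y\<in>L. S y) \<union> (F' - \<Union>NB) \<union> (\<Union>B\<in>Q - NB. piece B)"
    have hP: "h y \<in> P" if "y \<in> L" for y using QP(1) NBQ h(1)[OF that] by blast
    have "S y \<subseteq> E" if "y \<in> L" for y using S(1)[OF that] class_subset[OF hP[OF that]] by (rule subset_trans)
    moreover have "piece B \<subseteq> E" if "B \<in> Q" for B
      using piece(1)[OF that] class_subset[OF QP(1)[OF that]] by (rule subset_trans)
    ultimately have FE: "F \<subseteq> E"
      unfolding F_def using F'E by (intro Un_least UN_least) auto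
    have "card (\<Union>y\<in>L. S y) \<le> (\<Sum>y\<in>L. card (S y))" using fL by (rule card_UN_le)
    also have "\<dots> \<le> (\<Sum>y\<in>L. card (F' \<inter> h y) + 1)" using S(3) by (intro sum_mono) blast
    also have "\<dots> = (\<Sum>y\<in>L. card (F' \<inter> h y)) + card L" by (simp only: sum.distrib) simp
    also have "(\<Sum>y\<in>L. card (F' \<inter> h y)) = card (\<Union>y\<in>L. F' \<inter> h y)"
    proof (rule card_UN_disjoint[symmetric])
      show "\<forall>y\<in>L. finite (F' \<inter> h y)" using fF' by simp
      \<comment> \<open>The classes chosen for different runs are disjoint, so each edge of F' is
        charged at most once.\<close>
      have "y = z" if "y \<in> L" "z \<in> L" "e \<in> h y" "e \<in> h z" for y z e
      proof -
        have "y = g (h y)" using h(3)[OF that(1)] by (rule sym)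
        also have "h y = h z" by (rule class_eq[OF hP[OF that(1)] hP[OF that(2)] that(3,4)])
        also have "g (h z) = z" by (rule h(3)[OF that(2)])
        finally show ?thesis .
      qed
      then show "\<forall>y\<in>L. \<forall>z\<in>L. y \<noteq> z \<longrightarrow> (F' \<inter> h y) \<inter> (F' \<inter> h z) = {}" by blast
    qed (rule fL)
    also have "\<dots> \<le> card (F' \<inter> \<Union>NB)" using fF' h(1) by (intro card_mono) auto
    finally have c1: "card (\<Union>y\<in>L. S y) \<le> card (F' \<inter> \<Union>NB) + card L" by simp
    have "L \<subseteq> (\<lambda>B. lab (ix B)) ` NB" by (auto simp: L_def g_def)
    then have cL: "card L \<le> card (set w \<inter> ?br) + 1"
      using card_mono[OF finite_imageI[OF fNB]] cardlab le_trans by blast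
    have c2: "card (F' \<inter> \<Union>NB) + card (F' - \<Union>NB) = card F'"
      using fF' by (subst card_Un_disjoint[symmetric]) (auto intro: arg_cong[where f=card])
    have "card (Q - NB) \<le> card (set w \<inter> ?br)"
      by (rule card_inj_on_le[where f=Inr]) (auto simp: Q_def NB_def)
    then have "(\<Sum>B\<in>Q - NB. card (piece B)) \<le> card (set w \<inter> ?br) * m"
      using sum_bounded_above[of "Q - NB" "\<lambda>B. card (piece B)" m] short
      by (fastforce simp: NB_def intro: le_trans mult_right_mono)
    then have c3: "card (\<Union>B\<in>Q - NB. piece B) \<le> card (set w \<inter> ?br) * m"
      using card_UN_le[of "Q - NB" piece] fQ by simp
    have "card F \<le> card (\<Union>y\<in>L. S y) + card (F' - \<Union>NB) + card (\<Union>B\<in>Q - NB. piece B)"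
      unfolding F_def by (meson add_mono card_Un_le le_refl le_trans)
    also have "\<dots> \<le> card F' + (card (set w \<inter> ?br) + 1) + card (set w \<inter> ?br) * m" using c1 c2 c3 cL by linarith
    also have "\<dots> \<le> card F' + (4 * K + 8) * (m + 1)"
    proof -
      have "card (set w \<inter> ?br) * m \<le> (4 * K + 8) * m" using w(4) by (intro mult_right_mono) auto
      then show ?thesis using w(4) by (simp add: algebra_simps)
    qed
    finally have cF: "card F \<le> card F' + (4 * K + 8) * (m + 1)" .
    have "\<not> good D" if D: "D \<subseteq> E - F" for D
    proof
      assume gD: "good D"
      have DE: "D \<subseteq> E" using D by blast
      have sD: "simple_edges (D \<inter> B)" for B by (rule simple_edges_subset[OF simple]) (use DE in blast)
      have oD: "odds D = {}" using gD by (simp add: good_def circuit_odds)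
      define Z where "Z = trace D"
      have Z: "odds Z = {}" "Z \<noteq> {}" "Z \<subseteq> inc" "Z \<subseteq> I0"
        using trace_even[OF DE oD] trace_good_nonempty[OF gD DE] trace_subset_inc evenI0 unfolding Z_def by auto
      \<comment> \<open>B has degree 2 in the core, with neighbours \<open>a B\<close> and
        \<open>b B\<close>. The trace of D lies in the core, and at B its degree is even and not
        zero.\<close>
      have oddsNB: "odds (D \<inter> B) = {a B, b B}" if B: "B \<in> NB" "D \<inter> B \<noteq> {}" for B
      proof -
        have BQ: "B \<in> Q" and nbr: "Inr B \<notin> ?br" using B(1) by (auto simp: NB_def)
        have sub: "{v. {Inl v, Inr B} \<in> W} \<subseteq> {v. {Inl v, Inr B} \<in> I0}" using w(3) by (auto simp: W_def)
        have "card {v. {Inl v, Inr B} \<in> I0} = 2"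
          using deg2[of "Inr B"] BQ nbr unfolding Q_def deg_inc_class[OF I0] by simp
        moreover have "{v. {Inl v, Inr B} \<in> W} = {a B, b B}" using Wab[OF BQ] by auto
        then have "card {v. {Inl v, Inr B} \<in> W} = 2" using ab[OF BQ] by simp
        ultimately have "{v. {Inl v, Inr B} \<in> W} = {v. {Inl v, Inr B} \<in> I0}"
          using sub by (intro card_subset_eq) (auto intro: card_ge_0_finite)
        then have nb: "{v. {Inl v, Inr B} \<in> I0} = {a B, b B}" using \<open>{v. {Inl v, Inr B} \<in> W} = {a B, b B}\<close> by simp
        have "v \<in> {v. {Inl v, Inr B} \<in> I0}" if "v \<in> odds (D \<inter> B)" for v
        proof -
          have "{Inl v, Inr B} \<in> Z" unfolding Z_def trace_mem_iff using that QP(1)[OF BQ] by simp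
          then show ?thesis using Z(4) by blast
        qed
        then have o: "odds (D \<inter> B) \<subseteq> {a B, b B}" unfolding nb by blast
        have "odds (D \<inter> B) \<noteq> {}" using good_meets_class[OF gD QP(1)[OF BQ] B(2)] .
        moreover have "even (card (odds (D \<inter> B)))" using even_card_odds[OF sD] .
        ultimately show ?thesis using o by (intro even_subset_doubleton)
      qed
      \<comment> \<open>The edge of w that follows the node of B tells whether D enters B; these
        edges are what can be propagated along a run.\<close>
      have edge: "nth_edge w (ix B) \<in> Z \<longleftrightarrow> D \<inter> B \<noteq> {}" if B: "B \<in> NB" for B
      proof -
        have BQ: "B \<in> Q" using B NBQ by blast
        have e: "nth_edge w (ix B) \<in> W" unfolding W_def using ix(1)[OF B] by (rule nth_edge_in)
        have "Inr B \<in> nth_edge w (ix B)" using ix(2)[OF B] by (simp add: nth_edge_def)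
        moreover obtain v B' where vB: "nth_edge w (ix B) = {Inl v, Inr B'}" by (rule subset_incE[OF WI e])
        ultimately have vB: "nth_edge w (ix B) = {Inl v, Inr B}" by auto
        then have v: "v = a B \<or> v = b B" using e Wab[OF BQ] by simp
        show ?thesis
        proof (cases "D \<inter> B = {}")
          case True
          then show ?thesis unfolding vB Z_def trace_mem_iff by simp
        next
          case False
          then show ?thesis using oddsNB[OF B False] v QP(1)[OF BQ] unfolding vB Z_def trace_mem_iff by auto
        qed
      qed
      have follow: "nth_edge w i \<in> Z \<longleftrightarrow> nth_edge w i' \<in> Z"
        if "i \<le> i'" "i' < length w" "\<And>j. i < j \<Longrightarrow> j \<le> i' \<Longrightarrow> w ! j \<notin> ?br" for i i'
        using that
      proof (induction i' rule: dec_induct)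
        case (step j)
        have "w ! Suc j \<notin> ?br" using step by auto
        then have "deg I0 (w ! Suc j) = 2" using step.prems by (intro deg2) auto
        then have "nth_edge w j \<in> Z \<longleftrightarrow> nth_edge w (Suc j) \<in> Z"
          using cycle_propagate[OF w(1,2) step.prems(1) fI0 w(3) _ Z(4) even_deg_neq_1[OF Z(1)]] by blast
        moreover have "nth_edge w i \<in> Z \<longleftrightarrow> nth_edge w j \<in> Z" using step by auto
        ultimately show ?case by simp
      qed simp
      have same0: "nth_edge w i \<in> Z \<longleftrightarrow> nth_edge w i' \<in> Z" if "lab i = lab i'" "i \<le> i'" "i' < length w" for i i'
      proof (rule follow[OF that(2,3)])
        fix j assume "i < j" "j \<le> i'"
        then show "w ! j \<notin> ?br" using lab_ge[of j i'] lab_le[of i] that(1) by auto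
      qed
      have same: "D \<inter> B \<noteq> {} \<longleftrightarrow> D \<inter> B' \<noteq> {}" if "B \<in> NB" "B' \<in> NB" "g B = g B'" for B B'
      proof (cases "ix B \<le> ix B'")
        case True
        then show ?thesis using same0[of "ix B" "ix B'"] that(3) ix(1)[OF that(2)]
          unfolding g_def edge[OF that(1), symmetric] edge[OF that(2), symmetric] by blast
      next
        case False
        then have "ix B' \<le> ix B" by simp
        then show ?thesis using same0[of "ix B'" "ix B"] that(3)[symmetric] ix(1)[OF that(1)]
          unfolding g_def edge[OF that(1), symmetric] edge[OF that(2), symmetric] by blast
      qed
      \<comment> \<open>If F' separated B, then D would also cross the class chosen for the run of
        B, where F contains a cut.\<close>
      have notsep: "\<not> sep B" if B: "B \<in> NB" "D \<inter> B \<noteq> {}" for B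
      proof
        assume "sep B"
        then have y: "g B \<in> L" using B by (auto simp: L_def)
        let ?B = "h (g B)"
        have B1: "?B \<in> NB" "D \<inter> ?B \<noteq> {}" using same[of B ?B] h[OF y] B by auto
        have "?B \<in> Q" using B1 NBQ by blast
        then have cD: "conn (D \<inter> ?B) (a ?B) (b ?B)" by (rule chain_imp_conn2[OF sD oddsNB[OF B1] ab])
        have "D \<inter> ?B \<subseteq> ?B - S (g B)" using D y unfolding F_def by blast
        from conn_mono[OF this cD] S(2)[OF y] show False by (rule notE[rotated])
      qed
      have "\<exists>R. R \<subseteq> B - piece B - F' \<and> odds R = {a B, b B}" if B: "B \<in> NB" "D \<inter> B \<noteq> {}" for B
      proof -
        have BQ: "B \<in> Q" using B NBQ by blast
        have "simple_edges (B - piece B - F')" by (rule simple_edges_subset[OF class_simple[OF QP(1)[OF BQ]]]) blast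
        moreover have "conn (B - piece B - F') (a B) (b B)" using notsep[OF B] unfolding sep_def not_not .
        ultimately show ?thesis using conn_imp_chain2 ab[OF BQ] by metis
      qed
      then obtain r where r: "\<And>B. B \<in> NB \<Longrightarrow> D \<inter> B \<noteq> {} \<Longrightarrow> r B \<subseteq> B - piece B - F'"
        "\<And>B. B \<in> NB \<Longrightarrow> D \<inter> B \<noteq> {} \<Longrightarrow> odds (r B) = {a B, b B}" by metis
      \<comment> \<open>D is rerouted: in every non-branch class that it enters, its part is
        exchanged for a chain with the same odd vertices that avoids the piece and F'. The trace
        stays the same, so a good circuit of \<open>E - X\<close> survives F'.\<close>
      define f where "f B = (if B \<in> NB \<and> D \<inter> B \<noteq> {} then r B else D \<inter> B)" for B
      have fsub: "f B \<subseteq> B" for B using r(1)[of B] by (auto simp: f_def)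
      have fodd: "odds (f B) = odds (D \<inter> B)" for B using r(2)[of B] oddsNB[of B] by (auto simp: f_def)
      have "\<exists>C\<subseteq>(\<Union>B\<in>P. f B). good C"
      proof (rule assemble_good[OF _ Z(1,2,3)])
        show "f B \<subseteq> B" if "B \<in> P" for B by (rule fsub)
        show "v \<in> odds (f B) \<longleftrightarrow> {Inl v, Inr B} \<in> Z" if "B \<in> P" for B v
          unfolding Z_def trace_mem_iff fodd using that by simp
      qed
      moreover have "f B \<subseteq> E - X - F'" if B: "B \<in> P" for B
      proof
        fix e assume e: "e \<in> f B"
        then have eB: "e \<in> B" using fsub by blast
        show "e \<in> E - X - F'"
        proof (cases "B \<in> NB \<and> D \<inter> B \<noteq> {}")
          case True
          then have "e \<in> B - piece B - F'" "B \<in> Q" using e r(1)[of B] NBQ by (auto simp: f_def)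
          then show ?thesis using Xcap[OF B] class_subset[OF B] by auto
        next
          case False
          then have eD: "e \<in> D" "B \<notin> NB" using e eB by (auto simp: f_def)
          have "e \<notin> \<Union>NB" using eD(2) class_eq[OF B _ eB] QP(1) NBQ by blast
          moreover have "e \<notin> F" using eD(1) D by blast
          ultimately have "e \<notin> F'" "B \<in> Q \<Longrightarrow> e \<notin> piece B" using eD(2) unfolding F_def by blast+
          then have "e \<notin> X" using Xcap[OF B] eB by (auto split: if_splits)
          then show ?thesis using \<open>e \<notin> F'\<close> eB class_subset[OF B] by blast
        qed
      qed
      then have "(\<Union>B\<in>P. f B) \<subseteq> E - X - F'" by blast
      ultimately show False using F' unfolding hits_def by (meson subset_trans)
    qed
    then have "hits good E F" using FE by (simp add: hits_def)
    then show ?thesis using cF by blast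
  qed
  then show ?thesis using XE goodX by blast
qed

end

section \<open>Long circuits\<close>

lemma split_list_two:
  assumes "i < j" "j < length c"
  shows "\<exists>u s v. c = u @ [c ! i] @ s @ [c ! j] @ v \<and> length u = i \<and> length s = j - i - 1"
proof -
  have 1: "c = take i c @ c ! i # drop (Suc i) c" using assms by (intro id_take_nth_drop) simp
  let ?t = "drop (Suc i) c"
  have l: "j - Suc i < length ?t" using assms by simp
  have 2: "?t = take (j - Suc i) ?t @ ?t ! (j - Suc i) # drop (Suc (j - Suc i)) ?t"
    using l by (rule id_take_nth_drop)
  have "?t ! (j - Suc i) = c ! j" using assms by simp
  then have "c = take i c @ [c ! i] @ take (j - Suc i) ?t @ [c ! j] @ drop (Suc (j - Suc i)) ?t"
    using 1 2 by simp
  moreover have "length (take i c) = i" "length (take (j - Suc i) ?t) = j - i - 1" using assms by auto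
  ultimately show ?thesis by blast
qed

lemma cycle_edges_subset_iff:
  "q \<noteq> [] \<Longrightarrow> cycle_edges q \<subseteq> B \<longleftrightarrow> successively (\<lambda>u v. {u, v} \<in> B) q \<and> {last q, hd q} \<in> B"
  by (auto simp: cycle_edges_path path_edges_subset_iff[symmetric])

text \<open>Together with either arc of the cycle, the path p forms a cycle shorter than c, hence shorter
  than l; but the lengths of these two cycles add up to more than the length of c.\<close>

lemma no_shortcut:
  assumes c: "distinct c" "cycle_edges c \<subseteq> B" "2 * l \<le> length c"
    and minimal: "\<And>D. D \<subseteq> B \<Longrightarrow> circuit D \<Longrightarrow> card D < length c \<Longrightarrow> card D < l"
    and ij: "i < j" "j < length c"
    and p: "distinct p" "p \<noteq> []" "hd p = c ! i" "last p = c ! j" "path_edges p \<subseteq> B"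
      "set p \<inter> set c \<subseteq> {c ! i, c ! j}" "length p - 1 < j - i" "length p - 1 < length c - (j - i)"
  shows False
proof -
  define r where "r u v \<longleftrightarrow> {u, v} \<in> B" for u v
  have rsym: "r u v \<Longrightarrow> r v u" for u v by (simp add: r_def insert_commute)
  have r_eq: "r = (\<lambda>u v. {u, v} \<in> B)" by (intro ext) (simp add: r_def)
  have "(\<lambda>u v. r v u) = r" by (intro ext) (simp add: r_def insert_commute)
  then have srev: "successively (\<lambda>u v. r v u) q = successively r q" for q by (rule arg_cong)
  have short: "length q < l" if "distinct q" "3 \<le> length q" "successively r q" "r (last q) (hd q)" "length q < length c" for q
  proof -
    have "q \<noteq> []" using that by auto
    then have "cycle_edges q \<subseteq> B" using that(3,4) cycle_edges_subset_iff[of q B] unfolding r_eq by simp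
    moreover have "circuit (cycle_edges q)" using that by (auto simp: circuit_def)
    ultimately show ?thesis using minimal[of "cycle_edges q"] card_cycle_edges[OF that(2,1)] that(5) by simp
  qed
  obtain u s v where usv: "c = u @ [c ! i] @ s @ [c ! j] @ v" "length u = i" "length s = j - i - 1"
    using split_list_two[OF ij] by blast
  define x where "x = c ! i"
  define y where "y = c ! j"
  have ceq: "c = u @ x # s @ y # v" using usv(1) by (simp add: x_def y_def)
  have cne: "c \<noteq> []" using ceq by simp
  have "successively r c \<and> r (last c) (hd c)"
    using c(2) cycle_edges_subset_iff[OF cne, of B] unfolding r_eq by simp
  then have sc: "successively r (u @ x # s @ y # v)" "r (last (y # v)) (hd (u @ [x]))"
    unfolding ceq by (auto simp: hd_append)
  have ps: "successively r p" using p(5) unfolding path_edges_subset_iff r_eq .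
  have pxy: "hd p = x" "last p = y" using p by (simp_all add: x_def y_def)
  have dc: "distinct (u @ x # s @ y # v)" using c(1) ceq by simp
  have "set p \<inter> set c \<subseteq> {x, y}" using p(6) unfolding x_def y_def .
  then have pint: "set p \<inter> set (u @ x # s @ y # v) \<subseteq> {x, y}" by (simp only: ceq[symmetric])
  have lc: "length c = i + length s + length v + 2" "length s + 1 = j - i"
    using arg_cong[OF ceq, of length] usv(2,3) ij by simp_all
  have "x \<noteq> y" using dc by auto
  then have "length p \<noteq> 1" using pxy by (auto simp: length_Suc_conv)
  moreover have "length p \<noteq> 0" using p(2) by simp
  ultimately have lp: "2 \<le> length p" by linarith
  \<comment> \<open>The path followed by the inner part of the arc between positions i and j,
    traversed backwards.\<close>
  have "length (p @ rev s) < l"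
  proof (rule short)
    show "distinct (p @ rev s)" using p(1) dc pint by auto
    show "3 \<le> length (p @ rev s)" using lp lc p(7) by simp
    show "successively r (p @ rev s)" using ps sc(1) pxy(2) p(2) rsym[of "last s" y]
      by (cases "s = []") (simp_all add: successively_append_iff successively_Cons hd_rev srev)
    show "r (last (p @ rev s)) (hd (p @ rev s))" using sc(1) pxy p(2) rsym[of x "hd s"] rsym[of x y]
      by (cases "s = []") (simp_all add: successively_append_iff successively_Cons last_rev)
    show "length (p @ rev s) < length c" using p(8) lc lp by simp
  qed
  \<comment> \<open>The other arc, which passes through the end of the list.\<close>
  moreover have "length (p @ v @ u) < l"
  proof (rule short)
    show "distinct (p @ v @ u)" using p(1) dc pint by auto
    show "3 \<le> length (p @ v @ u)" using lp lc p(8) ij usv(2) by simp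
    show "successively r (p @ v @ u)" using ps sc pxy(2) p(2)
      by (auto simp: successively_append_iff successively_Cons hd_append split: if_splits)
    show "r (last (p @ v @ u)) (hd (p @ v @ u))" using sc pxy p(2)
      by (cases u rule: rev_cases) (auto simp: successively_append_iff hd_append split: if_splits)
    show "length (p @ v @ u) < length c" using p(7) lc lp usv(2) by simp
  qed
  \<comment> \<open>The two lengths add up to \<open>2 * length p + length c - 2\<close>, at least
    \<open>length c + 2\<close>, but each is below l.\<close>
  ultimately show False using c(3) lc lp usv(2) by simp
qed

section \<open>Classes of edges on common short circuits\<close>

text \<open>The clause \<open>e = f\<close> puts an edge that lies on no short circuit into a class
  of its own.\<close>

definition same_class :: "nat \<Rightarrow> 'a set set \<Rightarrow> 'a set \<Rightarrow> 'a set \<Rightarrow> bool" where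
  "same_class l E e f \<longleftrightarrow> e = f \<or> (\<exists>C\<subseteq>E. circuit C \<and> card C < l \<and> e \<in> C \<and> f \<in> C)"

definition edge_classes :: "nat \<Rightarrow> 'a set set \<Rightarrow> 'a set set set" where
  "edge_classes l E = (\<lambda>e. {f \<in> E. same_class l E e f}) ` E"

text \<open>The factor 4 gives room twice: two short circuits together have fewer than W edges, and
  a long circuit is long enough to be shortcut by a chain of l - 1 edges.\<close>

locale length_gap =
  fixes E :: "'a set set" and l W :: nat
  assumes simple_E: "simple_edges E" and l2: "2 \<le> l" and Wl: "4 * l \<le> W"
    and gap: "\<And>C. C \<subseteq> E \<Longrightarrow> circuit C \<Longrightarrow> card C < l \<or> W < card C"
begin

abbreviation "cls \<equiv> edge_classes l E"

lemma same_class_sym: "same_class l E e f \<Longrightarrow> same_class l E f e"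
  unfolding same_class_def by blast

text \<open>\<open>circuit_union\<close> yields a circuit through e and h with fewer than 2 l edges,
  and the gap makes it shorter than l.\<close>

lemma same_class_trans:
  assumes "same_class l E e f" "same_class l E f h"
  shows "same_class l E e h"
proof (cases "e = f \<or> f = h")
  case True
  then show ?thesis using assms by auto
next
  case False
  then obtain C1 C2 where C: "C1 \<subseteq> E" "circuit C1" "card C1 < l" "e \<in> C1" "f \<in> C1"
      "C2 \<subseteq> E" "circuit C2" "card C2 < l" "f \<in> C2" "h \<in> C2"
    using assms unfolding same_class_def by blast
  then have "C1 \<inter> C2 \<noteq> {}" by blast
  then obtain C3 where C3: "C3 \<subseteq> C1 \<union> C2" "circuit C3" "e \<in> C3" "h \<in> C3"
    using circuit_union[OF C(2,7,4,10)] by blast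
  have "finite (C1 \<union> C2)" using C circuit_simple simple_edges_finite by blast
  then have "card C3 \<le> card (C1 \<union> C2)" using C3(1) by (rule card_mono)
  also have "\<dots> \<le> card C1 + card C2" by (rule card_Un_le)
  finally have "\<not> W < card C3" using C(3,8) Wl by linarith
  moreover have C3E: "C3 \<subseteq> E" using C3(1) C(1,6) by blast
  ultimately have "card C3 < l" using gap[OF C3E C3(2)] by blast
  then show ?thesis unfolding same_class_def using C3 C3E by blast
qed

lemma class_memI: "B \<in> cls \<Longrightarrow> e \<in> B \<Longrightarrow> f \<in> E \<Longrightarrow> same_class l E e f \<Longrightarrow> f \<in> B"
  unfolding edge_classes_def using same_class_trans by auto

lemma class_memD: "B \<in> cls \<Longrightarrow> e \<in> B \<Longrightarrow> f \<in> B \<Longrightarrow> same_class l E e f"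
  unfolding edge_classes_def using same_class_trans same_class_sym by blast

lemma edge_class_subset: "B \<in> cls \<Longrightarrow> B \<subseteq> E"
  by (auto simp: edge_classes_def)

lemma partition_classes: "partition_on E cls"
proof (rule partition_onI)
  show "\<Union>cls = E" by (auto simp: edge_classes_def same_class_def)
  show "{} \<notin> cls" by (auto simp: edge_classes_def same_class_def)
  fix B B' assume B: "B \<in> cls" "B' \<in> cls" "B \<noteq> B'"
  show "disjnt B B'"
  proof (rule ccontr)
    assume "\<not> disjnt B B'"
    then obtain e where e: "e \<in> B" "e \<in> B'" by (auto simp: disjnt_iff)
    have "f \<in> B'" if "f \<in> B" for f
      using class_memI[OF B(2) e(2)] class_memD[OF B(1) e(1) that] edge_class_subset[OF B(1)] that by blast
    moreover have "f \<in> B" if "f \<in> B'" for f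
      using class_memI[OF B(1) e(1)] class_memD[OF B(2) e(2) that] edge_class_subset[OF B(2)] that by blast
    ultimately show False using B(3) by blast
  qed
qed

lemma short_circuit_in_class:
  assumes "C \<subseteq> E" "circuit C" "card C < l" "B \<in> cls" "e \<in> C" "e \<in> B"
  shows "C \<subseteq> B"
proof
  fix f assume "f \<in> C"
  then have "same_class l E e f" unfolding same_class_def using assms by blast
  then show "f \<in> B" using class_memI[OF assms(4,6)] \<open>f \<in> C\<close> assms(1) by blast
qed

text \<open>The diameter bound. Two edges of a class lie on a circuit with at most l - 1 edges, and
  it contains a chain between the two vertices; if one edge holds both, \<open>2 \<le> l\<close>
  leaves room for it.\<close>

lemma class_chain:
  assumes B: "B \<in> cls" and p: "p \<in> \<Union>B" and q: "q \<in> \<Union>B" and "p \<noteq> q"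
  shows "\<exists>R\<subseteq>B. card R \<le> l - 1 \<and> odds R = {p, q}"
proof -
  obtain e f where ef: "e \<in> B" "p \<in> e" "f \<in> B" "q \<in> f" using p q by blast
  have sB: "simple_edges B" by (rule simple_edges_subset[OF simple_E edge_class_subset[OF B]])
  show ?thesis
  proof (cases "e = f")
    case True
    obtain x y where "e = {x, y}" by (rule simple_edgesE[OF sB ef(1)])
    then have "e = {p, q}" using True ef \<open>p \<noteq> q\<close> by blast
    then show ?thesis using ef(1) l2 by (intro exI[of _ "{e}"]) simp
  next
    case False
    then obtain C where C: "C \<subseteq> E" "circuit C" "card C < l" "e \<in> C" "f \<in> C"
      using class_memD[OF B ef(1,3)] unfolding same_class_def by blast
    have CB: "C \<subseteq> B" by (rule short_circuit_in_class[OF C(1-3) B C(4) ef(1)])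
    have "conn C p q" using C(2) by (rule circuit_edges_conn) (use C ef in blast)+
    then obtain R where R: "R \<subseteq> C" "odds R = {p, q}"
      using conn_imp_chain2[OF circuit_simple[OF C(2)] _ \<open>p \<noteq> q\<close>] by blast
    have "R \<noteq> C" using R(2) circuit_odds[OF C(2)] by auto
    then have "card R < card C" using R(1) simple_edges_finite[OF circuit_simple[OF C(2)]]
      by (intro psubset_card_mono) auto
    then have "card R \<le> l - 1" using C(3) by linarith
    then show ?thesis using R CB by blast
  qed
qed

text \<open>A shortest long circuit of the class has more than 4 l edges, while opposite vertices
  are at most l - 1 apart in the class. A shortest path that beats the distance of its ends along
  the circuit meets it only in these ends, against \<open>no_shortcut\<close>.\<close>

lemma class_no_long_circuit:
  assumes B: "B \<in> cls" and C: "C \<subseteq> B" "circuit C"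
  shows "card C < l"
proof (rule ccontr)
  assume "\<not> card C < l"
  define lng where "lng n \<longleftrightarrow> (\<exists>D\<subseteq>B. circuit D \<and> card D = n \<and> l \<le> n)" for n
  have "lng (card C)" using C \<open>\<not> card C < l\<close> by (auto simp: lng_def)
  then obtain n where n: "lng n" "\<And>m. m < n \<Longrightarrow> \<not> lng m" using exists_least_iff[of lng] by blast
  then obtain D where D: "D \<subseteq> B" "circuit D" "card D = n" "l \<le> n" by (auto simp: lng_def)
  then obtain c where c: "3 \<le> length c" "distinct c" "cycle_edges c = D" by (auto simp: circuit_def)
  have len: "length c = n" using card_cycle_edges[OF c(1,2)] c(3) D(3) by simp
  have minimal: "card D' < l" if "D' \<subseteq> B" "circuit D'" "card D' < length c" for D'
  proof (rule ccontr)
    assume "\<not> card D' < l"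
    then have "lng (card D')" using that(1,2) by (auto simp: lng_def)
    then show False using n(2)[of "card D'"] that(3) len by simp
  qed
  have n4: "4 * l < n" using gap[OF subset_trans[OF D(1) edge_class_subset[OF B]] D(2)] D(3,4) Wl by linarith
  have sB: "simple_edges B" by (rule simple_edges_subset[OF simple_E edge_class_subset[OF B]])
  \<comment> \<open>Distance along the circuit between positions i and j.\<close>
  define d where "d i j = (let k = (if i \<le> j then j - i else i - j) in min k (n - k))" for i j
  have d_tri: "d i j \<le> d i h + d h j" if "i < n" "j < n" "h < n" for i j h
  proof -
    define k where "k x y = (if x \<le> y then y - x else x - y)" for x y :: nat
    have kint: "int (k x y) = \<bar>int x - int y\<bar>" for x y by (simp add: k_def)
    have "int (k i j) \<le> int (k i h) + int (k h j)" "int (k i h) \<le> int (k i j) + int (k h j)"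
      "int (k h j) \<le> int (k i j) + int (k i h)" unfolding kint by linarith+
    moreover have "int (k i j) + int (k i h) + int (k h j) \<le> 2 * int n" "int (k i j) < int n"
      "int (k i h) < int n" "int (k h j) < int n"
      using that unfolding kint by linarith+
    ultimately have "k i j \<le> k i h + k h j" "k i h \<le> k i j + k h j" "k h j \<le> k i j + k i h"
      "k i j + k i h + k h j \<le> 2 * n" "k i j < n" "k i h < n" "k h j < n" by linarith+
    moreover have "min a a' \<le> min b b' + min c c'"
      if "a \<le> b + c" "b \<le> a + c" "c \<le> a + b" "a + b + c \<le> 2 * n" "a + a' = n" "b + b' = n" "c + c' = n"
      for a b c a' b' c'
      using that by (cases "b \<le> b'"; cases "c \<le> c'"; cases "a \<le> a'") simp_all
    ultimately show ?thesis unfolding d_def Let_def k_def[symmetric] by simp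
  qed
  define cand where "cand m \<longleftrightarrow> (\<exists>i j p. i < n \<and> j < n \<and> p \<noteq> [] \<and> distinct p \<and> hd p = c ! i \<and> last p = c ! j
      \<and> path_edges p \<subseteq> B \<and> length p = m \<and> length p - 1 < d i j)" for m
  have "\<exists>m. cand m"
  proof -
    let ?h = "n div 2"
    have h: "?h < n" "0 < n" "0 \<noteq> ?h" using n4 l2 by auto
    have "c ! 0 \<noteq> c ! ?h" using h c(2) len by (simp add: nth_eq_iff_index_eq)
    moreover have "c ! 0 \<in> \<Union>B" "c ! ?h \<in> \<Union>B"
      using nth_edge_in[of 0 c] nth_edge_in[of ?h c] h len c(3) D(1) by (auto simp: nth_edge_def)
    ultimately obtain R where R: "R \<subseteq> B" "card R \<le> l - 1" "odds R = {c ! 0, c ! ?h}"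
      using class_chain[OF B] by blast
    have sR: "simple_edges R" by (rule simple_edges_subset[OF sB R(1)])
    have "conn R (c ! 0) (c ! ?h)" using chain_imp_conn2[OF sR R(3) \<open>c ! 0 \<noteq> c ! ?h\<close>] .
    then obtain p where p: "p \<noteq> []" "hd p = c ! 0" "last p = c ! ?h" "distinct p" "path_edges p \<subseteq> R"
      using rtranclp_imp_path path_edges_subset_iff by metis
    have "length p - 1 \<le> l - 1"
      using card_mono[OF simple_edges_finite[OF sR] p(5)] card_path_edges[OF p(4)] R(2) by simp
    also have "\<dots> < d 0 ?h"
    proof -
      have "2 * l \<le> ?h" "?h \<le> n - ?h" using n4 by presburger+
      then show ?thesis using l2 by (simp add: d_def Let_def)
    qed
    finally have "length p - 1 < d 0 ?h" .
    then have "cand (length p)" unfolding cand_def using p h subset_trans[OF p(5) R(1)]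
      by (intro exI[of _ 0] exI[of _ ?h] exI[of _ p]) simp
    then show ?thesis by blast
  qed
  then obtain m where m: "cand m" "\<And>m'. m' < m \<Longrightarrow> \<not> cand m'" using exists_least_iff[of cand] by blast
  then obtain i j p where p: "i < n" "j < n" "p \<noteq> []" "distinct p" "hd p = c ! i" "last p = c ! j"
      "path_edges p \<subseteq> B" "length p = m" "length p - 1 < d i j" by (auto simp: cand_def)
  have interior: "set p \<inter> set c \<subseteq> {c ! i, c ! j}"
  proof (rule ccontr)
    assume "\<not> ?thesis"
    then obtain x where x: "x \<in> set p" "x \<in> set c" "x \<noteq> c ! i" "x \<noteq> c ! j" by blast
    obtain h where h: "h < n" "c ! h = x" using x(2) len by (auto simp: in_set_conv_nth)
    obtain p1 p2 where p12: "p = p1 @ x # p2" using x(1) by (meson split_list)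
    have ne: "p1 \<noteq> []" "p2 \<noteq> []" using x p(5,6) p12 by auto
    have e: "path_edges (p1 @ [x]) \<subseteq> B" "path_edges (x # p2) \<subseteq> B"
      using p(7) p12 unfolding path_edges_subset_iff by (auto simp: successively_append_iff)
    \<comment> \<open>As p is shortest, neither of its parts at x beats the distance of its ends; by
      the triangle inequality neither would p.\<close>
    have "\<not> length p1 < d i h"
    proof
      assume "length p1 < d i h"
      then have "cand (Suc (length p1))" unfolding cand_def using p p12 ne h e
        by (intro exI[of _ i] exI[of _ h] exI[of _ "p1 @ [x]"]) auto
      then show False using m(2)[of "Suc (length p1)"] p(8) p12 ne(2) by (cases p2) simp_all
    qed
    moreover have "\<not> length p2 < d h j"
    proof
      assume "length p2 < d h j"
      then have "cand (Suc (length p2))" unfolding cand_def using p p12 ne h e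
        by (intro exI[of _ h] exI[of _ j] exI[of _ "x # p2"]) auto
      then show False using m(2)[of "Suc (length p2)"] p(8) p12 ne(1) by (cases p1) simp_all
    qed
    ultimately show False using d_tri[OF p(1,2) h(1)] p(9) p12 by simp
  qed
  have cB: "cycle_edges c \<subseteq> B" using c(3) D(1) by simp
  have l2n: "2 * l \<le> length c" using n4 len by simp
  have "i \<noteq> j" using p(9) by (auto simp: d_def)
  then consider "i < j" | "j < i" by linarith
  then show False
  proof cases
    case 1
    then show False
      using no_shortcut[OF c(2) cB l2n minimal 1 _ p(4,3,5,6,7) interior] p len
      by (simp add: d_def)
  next
    case 2
    have "rev p \<noteq> []" "distinct (rev p)" "hd (rev p) = c ! j" "last (rev p) = c ! i" "path_edges (rev p) \<subseteq> B"
      "set (rev p) \<inter> set c \<subseteq> {c ! j, c ! i}"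
      using p interior by (auto simp: hd_rev last_rev path_edges_rev)
    then show False
      using no_shortcut[OF c(2) cB l2n minimal 2, of "rev p"] p len 2
      by (simp add: d_def)
  qed
qed

sublocale edge_partition E cls
  using simple_E partition_classes by unfold_locales

text \<open>A circuit shorter than l lies in the class of any of its edges, and classes contain no
  other circuits.\<close>

lemma good_iff_long:
  assumes "C \<subseteq> E"
  shows "good C \<longleftrightarrow> circuit C \<and> l \<le> card C"
proof
  assume g: "good C"
  then have C: "circuit C" by (simp add: good_def)
  obtain e where e: "e \<in> C" using circuit_nonempty[OF C] by blast
  obtain B where B: "B \<in> cls" "e \<in> B" using in_class[of e] e assms by blast
  have "\<not> card C < l" using short_circuit_in_class[OF assms C _ B(1) e B(2)] g B(1) by (auto simp: good_def)
  then show "circuit C \<and> l \<le> card C" using C by simp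
next
  assume "circuit C \<and> l \<le> card C"
  then show "good C" using class_no_long_circuit[of _ C] by (fastforce simp: good_def)
qed

lemma class_conn:
  assumes "B \<in> cls" "p \<in> \<Union>B" "q \<in> \<Union>B"
  shows "conn B p q"
proof (cases "p = q")
  case False
  obtain R where R: "R \<subseteq> B" "odds R = {p, q}" using class_chain[OF assms False] by blast
  have "conn R p q"
    using chain_imp_conn2[OF simple_edges_subset[OF class_simple[OF assms(1)] R(1)] R(2) False] .
  then show ?thesis by (rule conn_mono[OF R(1)])
qed simp

end

text \<open>W pays for one circuit in either way: for deleting a long circuit with at most W edges,
  and for the price \<open>(4 * K + 8) * l\<close> of \<open>good_reduction\<close> with m = l - 1,
  since \<open>l \<le> 2 * (l - 1)\<close>. K stays fixed during the induction.\<close>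

lemma long_circuit_packing_or_hitting:
  fixes l K :: nat
  defines "long \<equiv> \<lambda>C :: 'a set set. circuit C \<and> l \<le> card C"
  defines "W \<equiv> 2 * (l - 1) * (4 * K + 8)"
  assumes l: "2 \<le> l" and "simple_edges E" "k \<le> 2 ^ K"
  shows "packs long E k \<or> (\<exists>F. hits long E F \<and> card F \<le> k * W)"
  using assms(4,5)
proof (induction k arbitrary: E)
  case 0
  then show ?case by (auto simp: packs_def)
next
  case (Suc j)
  have sub: "simple_edges (E - X)" for X by (rule simple_edges_subset[OF Suc.prems(1)]) blast
  have IH: "packs long (E - X) j \<or> (\<exists>F. hits long (E - X) F \<and> card F \<le> j * W)" for X
    using Suc.IH[OF sub] Suc.prems(2) by simp
  consider (none) "\<forall>C\<subseteq>E. \<not> long C" | (short) C where "C \<subseteq> E" "long C" "card C \<le> W"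
    | (large) C where "C \<subseteq> E" "long C" "\<forall>C\<subseteq>E. long C \<longrightarrow> W < card C"
    by (meson not_le)
  then show ?case
  proof cases
    case none
    then have "hits long E {}" by (auto simp: hits_def)
    then show ?thesis by (intro disjI2 exI[of _ "{}"]) simp
  next
    case short
    consider "packs long (E - C) j" | F where "hits long (E - C) F" "card F \<le> j * W" using IH by blast
    then show ?thesis
    proof cases
      case 1
      then show ?thesis using packs_Suc[OF 1 short(2) subset_refl short(1)] by blast
    next
      case 2
      have "E - (F \<union> C) = E - C - F" by blast
      then have "hits long E (F \<union> C)" using 2(1) short(1) by (auto simp: hits_def)
      moreover have "card (F \<union> C) \<le> Suc j * W" using card_Un_le[of F C] 2(2) short(3) by simp
      ultimately show ?thesis by blast
    qed
  next
    case large
    have "4 * l \<le> W"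
    proof -
      have "2 * (l - 1) * 8 \<le> W" unfolding W_def by (intro mult_left_mono) auto
      then show ?thesis using l by linarith
    qed
    then interpret length_gap E l W
    proof (unfold_locales)
      show "card C < l \<or> W < card C" if "C \<subseteq> E" "circuit C" for C
        using large(3) that unfolding long_def by (meson not_le)
    qed (use Suc.prems(1) l in auto)
    have good_long: "good C \<longleftrightarrow> long C" if "C \<subseteq> E" for C
      unfolding long_def by (rule good_iff_long[OF that])
    show ?thesis
    proof (cases "card (core inc) \<le> card (\<Union>(core inc)) + Suc j * (4 * K + 8)")
      case False
      then have "packs good E (Suc j)" using good_packing_if_dense[OF class_conn Suc.prems(2)] by simp
      then show ?thesis using packs_mono[of good E "Suc j" E "Suc j" long] good_long by blast
    next
      case True
      have "good C" using large(1,2) good_long by simp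
      from good_reduction[OF class_chain Suc.prems(2) True this large(1)]
      obtain X D where X: "X \<subseteq> E" "D \<subseteq> X" "good D" and
        red: "\<And>F'. hits good (E - X) F' \<Longrightarrow> \<exists>F. hits good E F \<and> card F \<le> card F' + (4 * K + 8) * (l - 1 + 1)"
        by blast
      have longD: "long D" using X good_long[of D] by blast
      consider "packs long (E - X) j" | F where "hits long (E - X) F" "card F \<le> j * W" using IH by blast
      then show ?thesis
      proof cases
        case 1
        then show ?thesis using packs_Suc[OF 1 longD X(2,1)] by blast
      next
        case 2
        have "good C \<Longrightarrow> long C" if "C \<subseteq> E - X - F" for C using good_long[of C] that by blast
        then have "hits good (E - X) F" using 2(1) unfolding hits_def by blast
        then obtain F' where F': "hits good E F'" "card F' \<le> card F + (4 * K + 8) * (l - 1 + 1)"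
          using red by blast
        have "long C \<Longrightarrow> good C" if "C \<subseteq> E - F'" for C using good_long[of C] that by blast
        then have "hits long E F'" using F'(1) unfolding hits_def by blast
        moreover have "(4 * K + 8) * (l - 1 + 1) \<le> W"
        proof -
          have "l - 1 + 1 \<le> 2 * (l - 1)" using l by simp
          then have "(4 * K + 8) * (l - 1 + 1) \<le> (4 * K + 8) * (2 * (l - 1))" by (rule mult_left_mono) simp
          then show ?thesis unfolding W_def by (simp only: mult.commute)
        qed
        then have "card F' \<le> Suc j * W" using F'(2) 2(2) by simp
        ultimately show ?thesis by blast
      qed
    qed
  qed
qed

text \<open>K depends on k alone; the factor l contributes at least 1 to the logarithm, which is the
  gain of one in the second bound.\<close>

lemma ceiling_log_bounds:
  assumes "2 \<le> l" "1 \<le> k"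
  defines "K \<equiv> nat \<lceil>log 2 (real k)\<rceil>"
  shows "k \<le> 2 ^ K" "int K + 1 \<le> \<lceil>log 2 (real (k * l))\<rceil>"
proof -
  have pos: "0 \<le> log 2 (real k)" using assms(2) by simp
  then have K: "int K = \<lceil>log 2 (real k)\<rceil>" unfolding K_def by (simp add: ceiling_mono)
  then have "log 2 (real k) \<le> real K" by (metis le_of_int_ceiling of_int_of_nat_eq)
  then have "real k \<le> 2 powr real K" using assms(2) by (simp add: log_le_iff)
  then have "real k \<le> real (2 ^ K)" by (simp add: powr_realpow)
  then show "k \<le> 2 ^ K" by (simp only: of_nat_le_iff)
  have "log 2 (real (k * l)) = log 2 (real k) + log 2 (real l)" using assms by (simp add: log_mult)
  moreover have "1 \<le> log 2 (real l)" using assms(1) by (simp add: le_log_iff)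
  ultimately have "log 2 (real k) + 1 \<le> log 2 (real (k * l))" by simp
  then have "\<lceil>log 2 (real k) + 1\<rceil> \<le> \<lceil>log 2 (real (k * l))\<rceil>" by (rule ceiling_mono)
  then show "int K + 1 \<le> \<lceil>log 2 (real (k * l))\<rceil>" using K by simp
qed

theorem theorem1:
  fixes l k :: nat and G :: "'v ugraph"
  assumes "2 \<le> l" and "1 \<le> k" and "finite_simple_graph G"
  shows "(\<exists>C :: nat \<Rightarrow> 'v list.
            (\<forall>i<k. is_cycle G (C i) \<and> l \<le> length (C i)) \<and>
            (\<forall>i<k. \<forall>j<k. i \<noteq> j \<longrightarrow> cycle_edges (C i) \<inter> cycle_edges (C j) = {}))
       \<or> (\<exists>F \<subseteq> edges G.
            int (card F) \<le> 8 * int k * (int l - 1) * (\<lceil>log 2 (real (k * l))\<rceil> + 1) \<and>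
            (\<nexists>c. is_cycle (delete_edges G F) c \<and> l \<le> length c))"
proof -
  define K where "K = nat \<lceil>log 2 (real k)\<rceil>"
  have K: "k \<le> 2 ^ K" "int K + 1 \<le> \<lceil>log 2 (real (k * l))\<rceil>"
    using ceiling_log_bounds[OF assms(1,2)] by (simp_all add: K_def)
  have sub: "e \<subseteq> verts G" if "e \<in> edges G" for e using assms(3) that by (auto simp: finite_simple_graph_def)
  have "edges G \<subseteq> Pow (verts G)" using sub by blast
  then have simple: "simple_edges (edges G)"
    using assms(3) finite_subset[of "edges G" "Pow (verts G)"] by (auto simp: finite_simple_graph_def simple_edges_def)
  let ?long = "\<lambda>C. circuit C \<and> l \<le> card C"
  consider "packs ?long (edges G) k"
    | F where "hits ?long (edges G) F" "card F \<le> k * (2 * (l - 1) * (4 * K + 8))"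
    using long_circuit_packing_or_hitting[OF assms(1) simple K(1)] by blast
  then show ?thesis
  proof cases
    case 1
    then obtain f where f: "\<forall>i<k. ?long (f i) \<and> f i \<subseteq> edges G" "\<forall>i<k. \<forall>j<k. i \<noteq> j \<longrightarrow> f i \<inter> f j = {}"
      unfolding packs_def by blast
    have "\<exists>c. 3 \<le> length c \<and> distinct c \<and> cycle_edges c = f i" if "i < k" for i
      using f(1) that by (auto simp: circuit_def)
    then obtain C where C: "\<And>i. i < k \<Longrightarrow> 3 \<le> length (C i) \<and> distinct (C i) \<and> cycle_edges (C i) = f i" by metis
    have "is_cycle G (C i) \<and> l \<le> length (C i)" if i: "i < k" for i
    proof -
      have ne: "C i \<noteq> []" using C[OF i] by auto
      have "set (C i) \<subseteq> verts G"
        using Union_cycle_edges[OF ne] C[OF i] f(1) i sub by blast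
      moreover have "card (f i) = length (C i)" using card_cycle_edges C[OF i] by metis
      ultimately show ?thesis using C[OF i] f(1) i by (auto simp: is_cycle_def)
    qed
    moreover have "cycle_edges (C i) \<inter> cycle_edges (C j) = {}" if "i < k" "j < k" "i \<noteq> j" for i j
      using f(2) C that by simp
    ultimately show ?thesis by blast
  next
    case 2
    have "\<nexists>c. is_cycle (delete_edges G F) c \<and> l \<le> length c"
    proof
      assume "\<exists>c. is_cycle (delete_edges G F) c \<and> l \<le> length c"
      then obtain c where c: "3 \<le> length c" "distinct c" "cycle_edges c \<subseteq> edges G - F" "l \<le> length c"
        by (auto simp: is_cycle_def delete_edges_def)
      then have "circuit (cycle_edges c)" "l \<le> card (cycle_edges c)"
        using card_cycle_edges[OF c(1,2)] by (auto simp: circuit_def)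
      then show False using 2(1) c(3) by (auto simp: hits_def)
    qed
    moreover have "int (card F) \<le> 8 * int k * (int l - 1) * (\<lceil>log 2 (real (k * l))\<rceil> + 1)"
    proof -
      have "int (card F) \<le> int (k * (2 * (l - 1) * (4 * K + 8)))" using 2(2) by (simp only: of_nat_le_iff)
      also have "\<dots> = int k * (2 * int (l - 1) * (4 * int K + 8))"
        by (simp only: of_nat_mult of_nat_add of_nat_numeral)
      also have "int (l - 1) = int l - 1" using assms(1) by simp
      \<comment> \<open>The factor K + 2 is the one that the bound on K + 1 compares with the
        ceiling plus 1.\<close>
      also have "int k * (2 * (int l - 1) * (4 * int K + 8)) = 8 * int k * (int l - 1) * (int K + 2)"
        by (simp add: algebra_simps)
      also have "\<dots> \<le> 8 * int k * (int l - 1) * (\<lceil>log 2 (real (k * l))\<rceil> + 1)"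
        using K(2) assms(1) by (intro mult_left_mono) auto
      finally show ?thesis .
    qed
    moreover have "F \<subseteq> edges G" using 2(1) by (simp add: hits_def)
    ultimately show ?thesis by blast
  qed
qed

end
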